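(* Let $\Bbbk$ be a field and let $\mathcal{H}_O$ be the Grossman-Larson Hopf algebra of ordered trees over $\Bbbk$. The set of planted ordered trees freely generates the algebra $\mathcal{H}_O$. Moreover, $\mathcal{H}_O$ is isomorphic to the tensor Hopf algebra on the linear span of the set of planted ordered trees.
   Context: **Ordered trees and $\mathcal{H}_O$.** An ordered tree is a finite rooted tree with a linear (left-to-right) order on the children of each node. $x\backslash y$ is obtained by identifying the roots of $x$ and $y$, with the nodes of $x$ to the left of those of $y$. An ordered tree is planted if its root has exactly one child. Every ordered tree is uniquely $x=x_1\backslash\cdots\backslash x_k$ with $x_i$ planted (its planted components). $\mathrm{Nod}(y)$ is the set of nodes of $y$ (root included). For $f:[k]=\{1,\dots,k\}\to\mathrm{Nod}(y)$, $x\,\#_f\,y$ is the ordered tree obtained by identifying the root of each $x_i$ with the node $f(i)$ of $y$, keeping the order of the components of $x$ attached to the same node and placing them to the left of the children of that node in $y$. For $S=\{i_1<\cdots<i_p\}\subseteq[k]$, $x_S:=x_{i_1}\backslash\cdots\backslash x_{i_p}$, and $S^c=[k]\setminus S$. $\mathcal{H}_O$ is the vector space with basis the ordered trees, with $$x\cdot y=\sum_{f:[k]\to\mathrm{Nod}(y)}x\,\#_f\,y,\qquad \Delta(x)=\sum_{S\subseteq[k]}x_S\otimes x_{S^c}.$$ It is a graded Hopf algebra, the degree being one less than the number of nodes; the unit is the one-node tree. **Tensor Hopf algebra.** For a vector space $V$, $T(V)=\bigoplus_{k\ge0}V^{\otimes k}$ with the concatenation product (the free algebra on $V$) and the unique Hopf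 algebra structure for which $\Delta(v)=1\otimes v+v\otimes1$ and $\epsilon(v)=0$ for all $v\in V$. *)

theory Defs
  imports Complex_Main "HOL-Library.Poly_Mapping" "HOL-Library.FuncSet"
begin

section \<open>Vector spaces with a distinguished basis\<close>

text \<open>
  The vector space over a field \<open>'k\<close> with basis the elements of the type \<open>'b\<close> is the type
  \<open>'b \<Rightarrow>\<^sub>0 'k\<close> of finitely supported functions; the basis vector \<open>b\<close> is \<open>bas b\<close>.
  The tensor product of the spaces with bases \<open>'a\<close> and \<open>'b\<close> is the space with basis
  \<open>'a \<times> 'b\<close>, the basis vector \<open>(a, b)\<close> being the pure tensor of \<open>bas a\<close> and \<open>bas b\<close>.
\<close>

definition bas :: "'b \<Rightarrow> 'b \<Rightarrow>\<^sub>0 'k::field" where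
  "bas b = Poly_Mapping.single b 1"

definition smul :: "'k::field \<Rightarrow> ('b \<Rightarrow>\<^sub>0 'k) \<Rightarrow> ('b \<Rightarrow>\<^sub>0 'k)" where
  "smul c p = Poly_Mapping.map ((*) c) p"

lemma lookup_smul [simp]: "Poly_Mapping.lookup (smul c p) b = c * Poly_Mapping.lookup p b"
  by (simp add: smul_def Poly_Mapping.map.rep_eq when_def)

lemma vector_space_smul: "vector_space (smul :: 'k::field \<Rightarrow> ('b \<Rightarrow>\<^sub>0 'k) \<Rightarrow> _)"
  by standard (auto intro!: poly_mapping_eqI simp: lookup_add algebra_simps)

abbreviation lin :: "(('a \<Rightarrow>\<^sub>0 'k) \<Rightarrow> ('b \<Rightarrow>\<^sub>0 'k::field)) \<Rightarrow> bool" where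
  "lin f \<equiv> Vector_Spaces.linear smul smul f"

definition lin_ext :: "('a \<Rightarrow> 'b \<Rightarrow>\<^sub>0 'k) \<Rightarrow> ('a \<Rightarrow>\<^sub>0 'k) \<Rightarrow> ('b \<Rightarrow>\<^sub>0 'k::field)" where
  "lin_ext f p = (\<Sum>a\<in>Poly_Mapping.keys p. smul (Poly_Mapping.lookup p a) (f a))"

definition bilin_ext ::
  "('a \<Rightarrow> 'b \<Rightarrow> 'c \<Rightarrow>\<^sub>0 'k) \<Rightarrow> ('a \<Rightarrow>\<^sub>0 'k) \<Rightarrow> ('b \<Rightarrow>\<^sub>0 'k) \<Rightarrow> ('c \<Rightarrow>\<^sub>0 'k::field)" where
  "bilin_ext f p q = lin_ext (\<lambda>a. lin_ext (\<lambda>b. f a b) q) p"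

definition tens :: "('a \<Rightarrow>\<^sub>0 'k) \<Rightarrow> ('b \<Rightarrow>\<^sub>0 'k) \<Rightarrow> ('a \<times> 'b \<Rightarrow>\<^sub>0 'k::field)" where
  "tens = bilin_ext (\<lambda>a b. bas (a, b))"

definition tens_map ::
  "(('a \<Rightarrow>\<^sub>0 'k) \<Rightarrow> ('c \<Rightarrow>\<^sub>0 'k)) \<Rightarrow> (('b \<Rightarrow>\<^sub>0 'k) \<Rightarrow> ('d \<Rightarrow>\<^sub>0 'k)) \<Rightarrow>
     ('a \<times> 'b \<Rightarrow>\<^sub>0 'k) \<Rightarrow> ('c \<times> 'd \<Rightarrow>\<^sub>0 'k::field)" where
  "tens_map f g = lin_ext (\<lambda>(a, b). tens (f (bas a)) (g (bas b)))"

definition tens_assoc :: "(('a \<times> 'b) \<times> 'c \<Rightarrow>\<^sub>0 'k) \<Rightarrow> ('a \<times> ('b \<times> 'c) \<Rightarrow>\<^sub>0 'k::field)" where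
  "tens_assoc = lin_ext (\<lambda>((a, b), c). bas (a, (b, c)))"

section \<open>Hopf algebras\<close>

record (overloaded) ('b, 'k::field) hopf =
  hmult :: "('b \<Rightarrow>\<^sub>0 'k) \<Rightarrow> ('b \<Rightarrow>\<^sub>0 'k) \<Rightarrow> ('b \<Rightarrow>\<^sub>0 'k)"
  hunit :: "'b \<Rightarrow>\<^sub>0 'k"
  hcomult :: "('b \<Rightarrow>\<^sub>0 'k) \<Rightarrow> ('b \<times> 'b \<Rightarrow>\<^sub>0 'k)"
  hcounit :: "('b \<Rightarrow>\<^sub>0 'k) \<Rightarrow> 'k"

text \<open>The product as a linear map \<open>H \<otimes> H \<rightarrow> H\<close>.\<close>

definition mult_map :: "('b, 'k::field) hopf \<Rightarrow> ('b \<times> 'b \<Rightarrow>\<^sub>0 'k) \<Rightarrow> ('b \<Rightarrow>\<^sub>0 'k)" where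
  "mult_map H = lin_ext (\<lambda>(a, b). hmult H (bas a) (bas b))"

text \<open>The product \<open>(a \<otimes> b) (c \<otimes> d) = ac \<otimes> bd\<close> of the algebra \<open>H \<otimes> H\<close>.\<close>

definition tens_mult ::
  "('b, 'k::field) hopf \<Rightarrow> ('b \<times> 'b \<Rightarrow>\<^sub>0 'k) \<Rightarrow> ('b \<times> 'b \<Rightarrow>\<^sub>0 'k) \<Rightarrow> ('b \<times> 'b \<Rightarrow>\<^sub>0 'k)" where
  "tens_mult H =
     bilin_ext (\<lambda>(a, b) (c, d). tens (hmult H (bas a) (bas c)) (hmult H (bas b) (bas d)))"

definition assoc_algebra :: "('b, 'k::field) hopf \<Rightarrow> bool" where
  "assoc_algebra H \<longleftrightarrow>
     (\<forall>x. lin (\<lambda>y. hmult H x y)) \<and> (\<forall>y. lin (\<lambda>x. hmult H x y)) \<and>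
     (\<forall>x y z. hmult H (hmult H x y) z = hmult H x (hmult H y z)) \<and>
     (\<forall>x. hmult H (hunit H) x = x \<and> hmult H x (hunit H) = x)"

text \<open>The counit axioms use the identifications of \<open>'k \<otimes> H\<close> and \<open>H \<otimes> 'k\<close> with \<open>H\<close>.\<close>

definition coalgebra :: "('b, 'k::field) hopf \<Rightarrow> bool" where
  "coalgebra H \<longleftrightarrow>
     lin (hcomult H) \<and> Vector_Spaces.linear smul (*) (hcounit H) \<and>
     (\<forall>x. tens_assoc (tens_map (hcomult H) id (hcomult H x)) = tens_map id (hcomult H) (hcomult H x)) \<and>
     (\<forall>x. lin_ext (\<lambda>(a, b). smul (hcounit H (bas a)) (bas b)) (hcomult H x) = x) \<and>
     (\<forall>x. lin_ext (\<lambda>(a, b). smul (hcounit H (bas b)) (bas a)) (hcomult H x) = x)"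

definition bialgebra :: "('b, 'k::field) hopf \<Rightarrow> bool" where
  "bialgebra H \<longleftrightarrow> assoc_algebra H \<and> coalgebra H \<and>
     (\<forall>x y. hcomult H (hmult H x y) = tens_mult H (hcomult H x) (hcomult H y)) \<and>
     hcomult H (hunit H) = tens (hunit H) (hunit H) \<and>
     (\<forall>x y. hcounit H (hmult H x y) = hcounit H x * hcounit H y) \<and>
     hcounit H (hunit H) = 1"

definition is_antipode :: "('b, 'k::field) hopf \<Rightarrow> (('b \<Rightarrow>\<^sub>0 'k) \<Rightarrow> ('b \<Rightarrow>\<^sub>0 'k)) \<Rightarrow> bool" where
  "is_antipode H S \<longleftrightarrow> lin S \<and>
     (\<forall>x. mult_map H (tens_map S id (hcomult H x)) = smul (hcounit H x) (hunit H)) \<and>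
     (\<forall>x. mult_map H (tens_map id S (hcomult H x)) = smul (hcounit H x) (hunit H))"

definition hopf_algebra :: "('b, 'k::field) hopf \<Rightarrow> bool" where
  "hopf_algebra H \<longleftrightarrow> bialgebra H \<and> (\<exists>S. is_antipode H S)"

text \<open>Morphisms of bialgebras between Hopf algebras automatically preserve the antipode.\<close>

definition hopf_hom ::
  "('a, 'k::field) hopf \<Rightarrow> ('b, 'k) hopf \<Rightarrow> (('a \<Rightarrow>\<^sub>0 'k) \<Rightarrow> ('b \<Rightarrow>\<^sub>0 'k)) \<Rightarrow> bool" where
  "hopf_hom H K \<phi> \<longleftrightarrow> lin \<phi> \<and>
     (\<forall>x y. \<phi> (hmult H x y) = hmult K (\<phi> x) (\<phi> y)) \<and> \<phi> (hunit H) = hunit K \<and>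
     (\<forall>x. hcomult K (\<phi> x) = tens_map \<phi> \<phi> (hcomult H x)) \<and>
     (\<forall>x. hcounit K (\<phi> x) = hcounit H x)"

definition hopf_isomorphic :: "('a, 'k::field) hopf \<Rightarrow> ('b, 'k) hopf \<Rightarrow> bool" where
  "hopf_isomorphic H K \<longleftrightarrow> hopf_algebra H \<and> hopf_algebra K \<and> (\<exists>\<phi>. hopf_hom H K \<phi> \<and> bij \<phi>)"

text \<open>
  The free algebra on a set \<open>X\<close> is the space with basis the words in \<open>X\<close>. A subset \<open>X\<close> of an
  algebra freely generates it if the canonical algebra map from the free algebra on \<open>X\<close>,
  which sends a word to the product of its letters, is bijective.
\<close>

definition word_eval :: "('b, 'k::field) hopf \<Rightarrow> (('b \<Rightarrow>\<^sub>0 'k) list \<Rightarrow>\<^sub>0 'k) \<Rightarrow> ('b \<Rightarrow>\<^sub>0 'k)" where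
  "word_eval H = lin_ext (\<lambda>w. foldr (hmult H) w (hunit H))"

definition freely_generates :: "('b \<Rightarrow>\<^sub>0 'k::field) set \<Rightarrow> ('b, 'k) hopf \<Rightarrow> bool" where
  "freely_generates X H \<longleftrightarrow> bij_betw (word_eval H) {p. Poly_Mapping.keys p \<subseteq> lists X} UNIV"

section \<open>The tensor Hopf algebra\<close>

text \<open>
  For the space \<open>V\<close> with basis \<open>'v\<close>, the space \<open>V\<^bsup>\<otimes>n\<^esup>\<close> has as basis the words of length \<open>n\<close>
  in \<open>'v\<close>, hence \<open>T(V)\<close> has as basis \<open>'v list\<close>. The map \<open>letter\<close> is the inclusion \<open>V \<rightarrow> T(V)\<close>.
\<close>

definition letter :: "('v \<Rightarrow>\<^sub>0 'k::field) \<Rightarrow> ('v list \<Rightarrow>\<^sub>0 'k)" where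
  "letter = lin_ext (\<lambda>v. bas [v])"

definition tensor_hopf :: "('v list, 'k::field) hopf" where
  "tensor_hopf = (THE T. hopf_algebra T \<and>
     hmult T = bilin_ext (\<lambda>u w. bas (u @ w)) \<and> hunit T = bas [] \<and>
     (\<forall>v :: 'v \<Rightarrow>\<^sub>0 'k. hcomult T (letter v) = tens (hunit T) (letter v) + tens (letter v) (hunit T)) \<and>
     (\<forall>v :: 'v \<Rightarrow>\<^sub>0 'k. hcounit T (letter v) = 0))"

section \<open>Ordered trees\<close>

datatype otree = Node (children: "otree list")

abbreviation one_node :: otree where
  "one_node \<equiv> Node []"

definition merge :: "otree \<Rightarrow> otree \<Rightarrow> otree" where
  "merge x y = Node (children x @ children y)"

definition planted :: "otree \<Rightarrow> bool" where
  "planted x \<longleftrightarrow> length (children x) = 1"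

definition components :: "otree \<Rightarrow> otree list" where
  "components x = map (\<lambda>t. Node [t]) (children x)"

lemma size_nth_less [termination_simp]:
  fixes ts :: "otree list"
  shows "i < length ts \<Longrightarrow> size (ts ! i) < Suc (size_list size ts)"
  by (metis less_Suc_eq_le nth_mem order_refl size_list_estimation')

text \<open>A node is represented by the path of child indices leading to it from the root.\<close>

fun nodes :: "otree \<Rightarrow> nat list set" where
  "nodes (Node ts) = insert [] (\<Union>i\<in>{..<length ts}. (#) i ` nodes (ts ! i))"

text \<open>\<open>attach g y\<close> inserts the list \<open>g v\<close> to the left of the children of each node \<open>v\<close> of \<open>y\<close>.\<close>

fun attach :: "(nat list \<Rightarrow> otree list) \<Rightarrow> otree \<Rightarrow> otree" where
  "attach g (Node ts) =
     Node (g [] @ map (\<lambda>i. attach (\<lambda>p. g (i # p)) (ts ! i)) [0..<length ts])"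

text \<open>The tree \<open>x #\<^sub>f y\<close>. The components of \<open>x\<close> are indexed from 0.\<close>

definition graft :: "otree \<Rightarrow> (nat \<Rightarrow> nat list) \<Rightarrow> otree \<Rightarrow> otree" where
  "graft x f y = attach
     (\<lambda>v. concat (map (\<lambda>i. children (components x ! i))
                      (filter (\<lambda>i. f i = v) [0..<length (components x)]))) y"

text \<open>The tree \<open>x\<^sub>S\<close>; \<open>nths\<close> keeps the order of the components.\<close>

definition subtree :: "otree \<Rightarrow> nat set \<Rightarrow> otree" where
  "subtree x S = foldr merge (nths (components x) S) one_node"

section \<open>The Grossman-Larson Hopf algebra of ordered trees\<close>

definition gl_mult :: "otree \<Rightarrow> otree \<Rightarrow> (otree \<Rightarrow>\<^sub>0 'k::field)" where
  "gl_mult x y = (\<Sum>f\<in>{..<length (components x)} \<rightarrow>\<^sub>E nodes y. bas (graft x f y))"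

definition gl_comult :: "otree \<Rightarrow> (otree \<times> otree \<Rightarrow>\<^sub>0 'k::field)" where
  "gl_comult x = (\<Sum>S\<in>Pow {..<length (components x)}.
     bas (subtree x S, subtree x ({..<length (components x)} - S)))"

text \<open>The counit is the projection onto degree 0, that is, the coefficient of the one-node tree.\<close>

definition grossman_larson :: "(otree, 'k::field) hopf" where
  "grossman_larson =
     \<lparr> hmult = bilin_ext gl_mult,
       hunit = bas one_node,
       hcomult = lin_ext gl_comult,
       hcounit = (\<lambda>p. Poly_Mapping.lookup p one_node) \<rparr>"

text \<open>The planted ordered trees as a type; it indexes a basis of their linear span.\<close>

typedef planted_tree = "{x. planted x}"
  by (rule exI[of _ "Node [one_node]"]) (simp add: planted_def)

end

theory Submission
  imports Defs
begin

text \<open>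
  Grafting a tree \<open>t\<close> at all nodes of its argument is a linear map \<open>D\<^sub>t\<close>, and it is left multiplication
  by the planted tree \<open>Node [t]\<close>. It satisfies \<open>D\<^sub>t (Node us) = Node (t # us) + Node (d\<^sub>t us)\<close>, where
  \<open>d\<^sub>t\<close> is a derivation for concatenation of forests, and the two identities that matter are
  \<open>D\<^sub>t (x \<cdot> y) = D\<^sub>t x \<cdot> y\<close> and that \<open>d\<^sub>t\<close> is a coderivation for the unshuffling coproduct. By
  the first, sending a word to the product of its letters is a morphism \<open>\<phi>\<close> from the concatenation
  algebra; by the second, \<open>\<phi>\<close> is a morphism of coalgebras. Since \<open>d\<^sub>t us\<close> has fewer components than
  \<open>t # us\<close>, the equation \<open>Node (t # us) = D\<^sub>t (Node us) - Node (d\<^sub>t us)\<close> determines an inverse of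
  \<open>\<phi>\<close> recursively. All Hopf axioms of the Grossman-Larson algebra, associativity included, are then
  transported along \<open>\<phi>\<close> from the tensor algebra.
\<close>

section \<open>Linear extension\<close>

lemma lin_iff:
  "lin f \<longleftrightarrow> (\<forall>x y. f (x + y) = f x + f y) \<and> (\<forall>c x. f (smul c x) = smul c (f x))"
  by (simp add: Vector_Spaces.linear_iff vector_space_smul)

lemma lin_functional_iff:
  "Vector_Spaces.linear smul (*) (f :: ('a \<Rightarrow>\<^sub>0 'k::field) \<Rightarrow> 'k) \<longleftrightarrow>
     (\<forall>x y. f (x + y) = f x + f y) \<and> (\<forall>c x. f (smul c x) = c * f x)"
proof -
  have "vector_space ((*) :: 'k \<Rightarrow> 'k \<Rightarrow> 'k)"
    by standard (auto simp: algebra_simps)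
  then show ?thesis
    by (simp add: Vector_Spaces.linear_iff vector_space_smul)
qed

lemma linI:
  assumes "\<And>x y. f (x + y) = f x + f y" and "\<And>c x. f (smul c x) = smul c (f x)"
  shows "lin f"
  using assms by (simp add: lin_iff)

lemma lin_add: "lin f \<Longrightarrow> f (x + y) = f x + f y"
  and lin_smul: "lin f \<Longrightarrow> f (smul c x) = smul c (f x)"
  by (simp_all add: lin_iff)

lemma smul_simps [simp]:
  "smul 0 p = 0" "smul c 0 = 0" "smul 1 p = p" "smul c (smul d p) = smul (c * d) p"
  by (auto intro!: poly_mapping_eqI)

lemma smul_add: "smul c (p + q) = smul c p + smul c q"
  and smul_add_left: "smul (c + d) p = smul c p + smul d p"
  and smul_uminus: "smul (- c) p = - smul c p"
  by (auto intro!: poly_mapping_eqI simp: lookup_add algebra_simps)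

lemma smul_sum: "smul c (\<Sum>i\<in>I. f i) = (\<Sum>i\<in>I. smul c (f i))"
  by (induction I rule: infinite_finite_induct) (simp_all add: smul_add)

lemma lin_zero: "lin f \<Longrightarrow> f 0 = 0"
  by (metis lin_smul smul_simps(1))

lemma lin_sum: "lin f \<Longrightarrow> f (\<Sum>i\<in>I. g i) = (\<Sum>i\<in>I. f (g i))"
  by (induction I rule: infinite_finite_induct) (simp_all add: lin_zero lin_add)

lemma lookup_bas: "Poly_Mapping.lookup (bas a) b = (if a = b then 1 else 0)"
  by (simp add: bas_def lookup_single when_def)

lemma keys_bas [simp]: "Poly_Mapping.keys (bas a :: _ \<Rightarrow>\<^sub>0 'k::field) = {a}"
  by (simp add: bas_def)

lemma bas_inj: "(bas a :: _ \<Rightarrow>\<^sub>0 'k::field) = bas b \<longleftrightarrow> a = b"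
  by (metis keys_bas singleton_inject)

lemma lin_ext_superset:
  assumes "finite A" "Poly_Mapping.keys p \<subseteq> A"
  shows "lin_ext f p = (\<Sum>a\<in>A. smul (Poly_Mapping.lookup p a) (f a))"
  unfolding lin_ext_def using assms
  by (intro sum.mono_neutral_left) (auto simp: in_keys_iff)

lemma lin_ext_add [simp]: "lin_ext f (p + q) = lin_ext f p + lin_ext f q"
proof -
  let ?A = "Poly_Mapping.keys p \<union> Poly_Mapping.keys q"
  have "Poly_Mapping.keys (p + q) \<subseteq> ?A" by (rule keys_add)
  then show ?thesis
    by (simp add: lin_ext_superset[of ?A] lookup_add smul_add_left sum.distrib)
qed

lemma lin_ext_smul [simp]: "lin_ext f (smul c p) = smul c (lin_ext f p)"
proof -
  have "Poly_Mapping.keys (smul c p) \<subseteq> Poly_Mapping.keys p" by (auto simp: in_keys_iff)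
  then show ?thesis
    by (simp add: lin_ext_superset[of "Poly_Mapping.keys p"] smul_sum)
qed

lemma lin_lin_ext [simp]: "lin (lin_ext f)"
  by (rule linI) simp_all

lemma lin_ext_zero [simp]: "lin_ext f 0 = 0"
  by (simp add: lin_ext_def)

lemma lin_ext_diff [simp]: "lin_ext f (p - q) = lin_ext f p - lin_ext f q"
  by (metis lin_ext_add diff_add_cancel add_diff_cancel_right')

lemma lin_ext_sum [simp]: "lin_ext f (\<Sum>i\<in>I. p i) = (\<Sum>i\<in>I. lin_ext f (p i))"
  by (rule lin_sum) simp

lemma lin_ext_bas [simp]: "lin_ext f (bas a) = f a"
  by (simp add: lin_ext_def lookup_bas)

lemma lin_ext_id [simp]: "lin_ext bas p = p"
proof (rule poly_mapping_eqI)
  fix b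
  have "Poly_Mapping.lookup (lin_ext bas p) b
      = (\<Sum>a\<in>Poly_Mapping.keys p. Poly_Mapping.lookup p a * (if a = b then 1 else 0))"
    by (simp add: lin_ext_def lookup_sum lookup_bas)
  also have "\<dots> = Poly_Mapping.lookup p b"
    by (simp add: in_keys_iff if_distrib[of "(*) _"] cong: if_cong)
  finally show "Poly_Mapping.lookup (lin_ext bas p) b = Poly_Mapping.lookup p b" .
qed

lemma lin_apply: "lin f \<Longrightarrow> f (lin_ext g p) = lin_ext (\<lambda>a. f (g a)) p"
  by (simp add: lin_ext_def lin_sum lin_smul)

lemma lin_eq_lin_ext: "lin f \<Longrightarrow> f p = lin_ext (\<lambda>a. f (bas a)) p"
  by (metis lin_apply lin_ext_id)

lemma lin_eqI:
  assumes "lin f" "lin g" "\<And>a. f (bas a) = g (bas a)"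
  shows "f p = g p"
  using assms(3) by (simp add: lin_eq_lin_ext[OF assms(1), of p] lin_eq_lin_ext[OF assms(2), of p])

lemma lin_ext_bind [simp]: "lin_ext f (lin_ext g p) = lin_ext (\<lambda>a. lin_ext f (g a)) p"
  by (simp add: lin_apply)

lemma lin_ext_fun_add [simp]: "lin_ext (\<lambda>a. f a + g a) p = lin_ext f p + lin_ext g p"
  by (simp add: lin_ext_def smul_add sum.distrib)

lemma lin_ext_fun_smul [simp]: "lin_ext (\<lambda>a. smul c (f a)) p = smul c (lin_ext f p)"
  by (simp add: lin_ext_def smul_sum mult.commute)

lemma lin_ext_fun_zero [simp]: "lin_ext (\<lambda>a. 0) p = 0"
  by (simp add: lin_ext_def)

lemma lin_ext_fun_uminus [simp]: "lin_ext (\<lambda>a. - f a) p = - lin_ext f p"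
  using lin_ext_fun_smul[of "- 1" f p] by (simp add: smul_uminus)

lemma lin_ext_fun_diff [simp]: "lin_ext (\<lambda>a. f a - g a) p = lin_ext f p - lin_ext g p"
  using lin_ext_fun_add[of f "\<lambda>a. - g a" p] by simp

lemma lin_ext_fun_sum: "lin_ext (\<lambda>a. \<Sum>i\<in>I. f i a) p = (\<Sum>i\<in>I. lin_ext (f i) p)"
  by (induction I rule: infinite_finite_induct) simp_all

lemma lin_ext_commute:
  "lin_ext (\<lambda>a. lin_ext (\<lambda>b. f a b) q) p = lin_ext (\<lambda>b. lin_ext (\<lambda>a. f a b) p) q"
  by (simp add: lin_ext_def smul_sum mult.commute sum.swap[of _ "Poly_Mapping.keys q"])

lemma lin_comp: "lin f \<Longrightarrow> lin g \<Longrightarrow> lin (\<lambda>x. f (g x))"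
  by (simp add: lin_iff)

lemma lin_id: "lin id"
  by (simp add: lin_iff)

section \<open>Tensor products of spaces with bases, and of linear maps\<close>

lemma tens_eq: "tens p q = lin_ext (\<lambda>a. lin_ext (\<lambda>b. bas (a, b)) q) p"
  by (simp add: tens_def bilin_ext_def)

lemma tens_bas [simp]: "tens (bas a) (bas b) = bas (a, b)"
  by (simp add: tens_eq)

lemma lin_ext_tens: "lin_ext f (tens p q) = lin_ext (\<lambda>a. lin_ext (\<lambda>b. f (a, b)) q) p"
  by (simp add: tens_eq)

lemma tens_map_eq:
  "tens_map f g p = lin_ext (\<lambda>x. tens (f (bas (fst x))) (g (bas (snd x)))) p"
  by (simp add: tens_map_def case_prod_unfold)

lemma lin_tens_map [simp]: "lin (tens_map f g)"
  by (simp add: tens_map_def)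

lemma tens_map_bas [simp]: "tens_map f g (bas (a, b)) = tens (f (bas a)) (g (bas b))"
  by (simp add: tens_map_eq)

lemma lin_bilin_ext [simp]: "lin (bilin_ext f p)" "lin (\<lambda>p. bilin_ext f p q)"
  by (auto intro!: linI simp: bilin_ext_def)

lemma bilin_ext_bas [simp]: "bilin_ext f (bas a) (bas b) = f a b"
  by (simp add: bilin_ext_def)

lemma bilin_eqI:
  assumes "\<And>x. lin (f x)" "\<And>y. lin (\<lambda>x. f x y)" "\<And>x. lin (g x)" "\<And>y. lin (\<lambda>x. g x y)"
    and "\<And>a b. f (bas a) (bas b) = g (bas a) (bas b)"
  shows "f p q = g p q"
proof -
  have "f (bas a) q = g (bas a) q" for a
    by (rule lin_eqI) (simp_all add: assms)
  then show ?thesis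
    by (rule lin_eqI[where f = "\<lambda>p. f p q" and g = "\<lambda>p. g p q", OF assms(2,4)])
qed

lemma lin_tens: "lin (tens p)" "lin (\<lambda>p. tens p q)"
  unfolding tens_def by simp_all

lemma tens_map_tens:
  assumes "lin f" "lin g"
  shows "tens_map f g (tens p q) = tens (f p) (g q)"
  by (rule bilin_eqI[where f = "\<lambda>p q. tens_map f g (tens p q)" and g = "\<lambda>p q. tens (f p) (g q)"])
     (simp_all add: lin_comp[OF lin_tens_map] lin_tens lin_comp[OF lin_tens(1)]
       lin_comp[OF lin_tens(2)] assms)

lemma tens_map_comp:
  assumes "lin f" "lin g"
  shows "tens_map f g (tens_map f' g' p) = tens_map (\<lambda>x. f (f' x)) (\<lambda>x. g (g' x)) p"
proof -
  have "tens_map f g (tens_map f' g' p) =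
      lin_ext (\<lambda>x. tens_map f g (tens (f' (bas (fst x))) (g' (bas (snd x))))) p"
    unfolding tens_map_eq[of f' g'] by (rule lin_apply) simp
  then show ?thesis
    by (simp add: tens_map_tens assms) (simp add: tens_map_eq)
qed

lemma tens_assoc_eq: "tens_assoc p = lin_ext (\<lambda>x. bas (fst (fst x), snd (fst x), snd x)) p"
  by (simp add: tens_assoc_def case_prod_unfold)

lemma tens_mult_eq:
  "tens_mult H p q = lin_ext (\<lambda>x. lin_ext (\<lambda>y.
     tens (hmult H (bas (fst x)) (bas (fst y))) (hmult H (bas (snd x)) (bas (snd y)))) q) p"
  by (simp add: tens_mult_def bilin_ext_def case_prod_unfold)

section \<open>Scalar-valued functionals and coefficients\<close>

lemma linear_lookup: "Vector_Spaces.linear smul (*) (\<lambda>p. Poly_Mapping.lookup p b)"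
  by (simp add: lin_functional_iff lookup_add)

lemma functional_eqI:
  fixes e e' :: "('a \<Rightarrow>\<^sub>0 'k::field) \<Rightarrow> 'k"
  assumes e: "Vector_Spaces.linear smul (*) e" and e': "Vector_Spaces.linear smul (*) e'"
    and "\<And>a. e (bas a) = e' (bas a)"
  shows "e p = e' p"
proof -
  \<comment> \<open>Embedding the scalars as the space with a one-element basis turns functionals
    into maps to which \<open>lin_eqI\<close> applies; the coefficient at \<open>()\<close> recovers
    them.\<close>
  have "lin (\<lambda>p. smul (e p) (bas ()))" "lin (\<lambda>p. smul (e' p) (bas ()))"
    using e e' by (auto intro!: linI simp: lin_functional_iff smul_add_left)
  from lin_eqI[OF this, of p] assms(3)
  have "smul (e p) (bas ()) = smul (e' p) (bas ())" by simp
  from arg_cong[OF this, of "\<lambda>q. Poly_Mapping.lookup q ()"] show ?thesis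
    by (simp add: lookup_bas)
qed

lemma lin_functional_comp:
  "Vector_Spaces.linear smul (*) e \<Longrightarrow> lin f \<Longrightarrow> Vector_Spaces.linear smul (*) (\<lambda>x. e (f x))"
  by (simp add: lin_iff lin_functional_iff)

text \<open>Serves for the multiplicativity of the counit on words: \<open>u @ w = []\<close> forces
  both factors to be empty, so the coefficient of the empty word factors.\<close>

lemma lookup_bilin_ext:
  assumes "\<And>a b. Poly_Mapping.lookup (f a b) c = (if a = a0 \<and> b = b0 then 1 else 0)"
  shows "Poly_Mapping.lookup (bilin_ext f x y) c = Poly_Mapping.lookup x a0 * Poly_Mapping.lookup y b0"
proof -
  have 1: "Vector_Spaces.linear smul (*) (\<lambda>y. d * Poly_Mapping.lookup y b)"
    "Vector_Spaces.linear smul (*) (\<lambda>y. Poly_Mapping.lookup y b * d)" for b d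
    by (auto simp: lin_functional_iff lookup_add algebra_simps)
  have "Poly_Mapping.lookup (bilin_ext f (bas a) y) c
      = Poly_Mapping.lookup (bas a) a0 * Poly_Mapping.lookup y b0" for a
    by (rule functional_eqI[OF lin_functional_comp[OF linear_lookup lin_bilin_ext(1)] 1(1)])
       (simp add: assms lookup_bas)
  then show ?thesis
    by (rule functional_eqI[OF lin_functional_comp[OF linear_lookup lin_bilin_ext(2)] 1(2)])
qed

lemma lookup_lin_ext:
  "Poly_Mapping.lookup (lin_ext f p) b
    = (\<Sum>a\<in>Poly_Mapping.keys p. Poly_Mapping.lookup p a * Poly_Mapping.lookup (f a) b)"
  by (simp add: lin_ext_def lookup_sum)

lemma lin_ext_cong_keys:
  "(\<And>a. a \<in> Poly_Mapping.keys p \<Longrightarrow> f a = g a) \<Longrightarrow> lin_ext f p = lin_ext g p"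
  by (simp add: lin_ext_def)

text \<open>Renaming of the basis, undone by \<open>inv h\<close> on vectors supported in the range.
  It will replace the letters of words by basis vectors, as the definition of free generation
  requires.\<close>

lemma bij_betw_lin_ext_bas:
  fixes h :: "'a \<Rightarrow> 'b"
  assumes "inj h"
  shows "bij_betw (lin_ext (\<lambda>a. bas (h a)) :: _ \<Rightarrow> 'b \<Rightarrow>\<^sub>0 'k::field)
    UNIV {p. Poly_Mapping.keys p \<subseteq> range h}"
proof (rule bij_betw_byWitness[where f' = "lin_ext (\<lambda>b. bas (inv h b))"])
  show "\<forall>p\<in>UNIV. lin_ext (\<lambda>b. bas (inv h b)) (lin_ext (\<lambda>a. bas (h a)) p :: 'b \<Rightarrow>\<^sub>0 'k) = p"
    using assms by simp
  show "\<forall>p\<in>{p. Poly_Mapping.keys p \<subseteq> range h}.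
      lin_ext (\<lambda>a. bas (h a)) (lin_ext (\<lambda>b. bas (inv h b)) p) = (p :: 'b \<Rightarrow>\<^sub>0 'k)"
  proof
    fix p :: "'b \<Rightarrow>\<^sub>0 'k"
    assume "p \<in> {p. Poly_Mapping.keys p \<subseteq> range h}"
    then have "lin_ext (\<lambda>b. bas (h (inv h b))) p = lin_ext bas p"
      by (intro lin_ext_cong_keys) (auto simp: f_inv_into_f)
    then show "lin_ext (\<lambda>a. bas (h a)) (lin_ext (\<lambda>b. bas (inv h b)) p) = p"
      by simp
  qed
  show "(lin_ext (\<lambda>a. bas (h a)) :: _ \<Rightarrow> 'b \<Rightarrow>\<^sub>0 'k) ` UNIV \<subseteq> {p. Poly_Mapping.keys p \<subseteq> range h}"
  proof clarify
    fix p :: "'a \<Rightarrow>\<^sub>0 'k" and b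
    assume b: "b \<in> Poly_Mapping.keys (lin_ext (\<lambda>a. bas (h a)) p :: 'b \<Rightarrow>\<^sub>0 'k)"
    show "b \<in> range h"
    proof (rule ccontr)
      assume "b \<notin> range h"
      then have "h a \<noteq> b" for a
        by blast
      then show False
        using b by (simp add: in_keys_iff lookup_lin_ext lookup_bas)
    qed
  qed
qed auto

section \<open>Transport of Hopf structures\<close>

lemma lin_inv:
  assumes "lin f" "bij f"
  shows "lin (inv f)"
proof (rule linI)
  have f: "f (inv f y) = y" for y
    using assms(2) by (simp add: bij_is_surj surj_f_inv_f)
  have inv: "inv f (f x) = x" for x
    using assms(2) by (simp add: bij_is_inj)
  show "inv f (x + y) = inv f x + inv f y" for x y
    using inv[of "inv f x + inv f y"] by (simp add: lin_add[OF assms(1)] f)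
  show "inv f (smul c x) = smul c (inv f x)" for c x
    using inv[of "smul c (inv f x)"] by (simp add: lin_smul[OF assms(1)] f)
qed

lemma tens_map_ident [simp]: "tens_map (\<lambda>x. x) (\<lambda>x. x) p = p"
  by (simp add: tens_map_eq)

lemma tens_assoc_tens: "tens_assoc (tens (tens p q) r) = tens p (tens q r)"
  by (simp add: tens_assoc_eq tens_eq)

lemma tens_assoc_bas [simp]: "tens_assoc (bas ((a, b), c)) = bas (a, b, c)"
  by (simp add: tens_assoc_def)

lemma lin_tens_assoc: "lin tens_assoc"
  by (simp add: tens_assoc_def)

lemma tens_assoc_tens_map:
  assumes "lin f" "lin g" "lin h"
  shows "tens_assoc (tens_map (tens_map f g) h p) = tens_map f (tens_map g h) (tens_assoc p)"
proof (rule lin_eqI[where p = p])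
  show "lin (\<lambda>p. tens_assoc (tens_map (tens_map f g) h p))"
    by (intro lin_comp[OF lin_tens_assoc] lin_tens_map)
  show "lin (\<lambda>p. tens_map f (tens_map g h) (tens_assoc p))"
    by (intro lin_comp[OF lin_tens_map] lin_tens_assoc)
  show "tens_assoc (tens_map (tens_map f g) h (bas x))
      = tens_map f (tens_map g h) (tens_assoc (bas x))" for x
    by (cases x; cases "fst x") (simp add: tens_assoc_tens)
qed

lemma tens_mult_tens:
  assumes "\<And>x. lin (hmult H x)" "\<And>y. lin (\<lambda>x. hmult H x y)"
  shows "tens_mult H (tens p q) (tens r s) = tens (hmult H p r) (hmult H q s)"
proof -
  have lin1: "lin (\<lambda>p. tens_mult H p x)" "lin (tens_mult H x)" for x
    by (simp_all add: tens_mult_def)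
  have 1: "tens_mult H (bas (a, b)) (tens r s) = tens (hmult H (bas a) r) (hmult H (bas b) s)" for a b
  proof (rule bilin_eqI[where p = r and q = s])
    show "lin (\<lambda>s. tens_mult H (bas (a, b)) (tens r s))"
      "lin (\<lambda>r. tens_mult H (bas (a, b)) (tens r s))" for r s
      by (rule lin_comp[OF lin1(2)], rule lin_tens)+
    show "lin (\<lambda>s. tens (hmult H (bas a) r) (hmult H (bas b) s))" for r
      by (rule lin_comp[OF lin_tens(1)], rule assms)
    show "lin (\<lambda>r. tens (hmult H (bas a) r) (hmult H (bas b) s))" for s
      by (rule lin_comp[OF lin_tens(2)], rule assms)
    show "tens_mult H (bas (a, b)) (tens (bas c) (bas d))
        = tens (hmult H (bas a) (bas c)) (hmult H (bas b) (bas d))" for c d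
      by (simp add: tens_mult_eq)
  qed
  show ?thesis
  proof (rule bilin_eqI[where p = p and q = q])
    show "lin (\<lambda>q. tens_mult H (tens p q) (tens r s))"
      "lin (\<lambda>p. tens_mult H (tens p q) (tens r s))" for p q
      by (rule lin_comp[OF lin1(1)], rule lin_tens)+
    show "lin (\<lambda>q. tens (hmult H p r) (hmult H q s))" for p
      by (rule lin_comp[OF lin_tens(1)], rule assms)
    show "lin (\<lambda>p. tens (hmult H p r) (hmult H q s))" for q
      by (rule lin_comp[OF lin_tens(2)], rule assms)
    show "tens_mult H (tens (bas a) (bas b)) (tens r s)
        = tens (hmult H (bas a) r) (hmult H (bas b) s)" for a b
      by (simp add: 1)
  qed
qed

lemma tens_map_tens_mult:
  assumes "lin f" and "\<And>x y. f (hmult H x y) = hmult K (f x) (f y)"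
    and "\<And>x. lin (hmult K x)" "\<And>y. lin (\<lambda>x. hmult K x y)"
  shows "tens_map f f (tens_mult H p q) = tens_mult K (tens_map f f p) (tens_map f f q)"
proof (rule bilin_eqI[where p = p and q = q])
  have lin1: "lin (\<lambda>p. tens_mult L p x)" "lin (tens_mult L x)" for x and L :: "('c, 'k::field) hopf"
    by (simp_all add: tens_mult_def)
  show "lin (\<lambda>q. tens_map f f (tens_mult H p q))" "lin (\<lambda>p. tens_map f f (tens_mult H p q))" for p q
    by (auto intro!: lin_comp[OF lin_tens_map] simp: tens_mult_def)
  show "lin (\<lambda>q. tens_mult K (tens_map f f p) (tens_map f f q))" for p
    by (intro lin_comp[OF lin1(2)] lin_tens_map)
  show "lin (\<lambda>p. tens_mult K (tens_map f f p) (tens_map f f q))" for q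
    by (intro lin_comp[OF lin1(1)] lin_tens_map)
  show "tens_map f f (tens_mult H (bas x) (bas y))
      = tens_mult K (tens_map f f (bas x)) (tens_map f f (bas y))" for x y
    \<comment> \<open>On the \<open>K\<close> side the arguments are tensors of images under
      \<open>f\<close>, not basis vectors, so \<open>tens_mult_tens\<close> has to act before
      \<open>tens_mult_eq\<close> unfolds the \<open>H\<close> side.\<close>
    by (cases x; cases y)
       (simp add: tens_mult_tens assms, simp add: tens_mult_eq tens_map_tens assms)
qed

lemma mult_map_tens:
  assumes "\<And>x. lin (hmult H x)" "\<And>y. lin (\<lambda>x. hmult H x y)"
  shows "mult_map H (tens p q) = hmult H p q"
  by (rule bilin_eqI[where f = "\<lambda>p q. mult_map H (tens p q)" and g = "hmult H"])
     (simp_all add: mult_map_def lin_comp[OF lin_lin_ext] lin_tens assms)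

lemma mult_map_tens_map:
  assumes "lin f" and "\<And>x y. f (hmult H x y) = hmult K (f x) (f y)"
    and "\<And>x. lin (hmult K x)" "\<And>y. lin (\<lambda>x. hmult K x y)"
  shows "mult_map K (tens_map f f p) = f (mult_map H p)"
proof (rule lin_eqI[where p = p])
  show "lin (\<lambda>p. mult_map K (tens_map f f p))"
    unfolding mult_map_def by (intro lin_comp[OF lin_lin_ext] lin_tens_map)
  show "lin (\<lambda>p. f (mult_map H p))"
    unfolding mult_map_def by (intro lin_comp[OF assms(1)] lin_lin_ext)
  show "mult_map K (tens_map f f (bas x)) = f (mult_map H (bas x))" for x
    by (cases x) (simp add: mult_map_tens assms, simp add: mult_map_def assms)
qed

lemma counit_tens:
  assumes "Vector_Spaces.linear smul (*) e"
  shows "lin_ext (\<lambda>(a, b). smul (e (bas a)) (bas b)) (tens p q) = smul (e p) q"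
    and "lin_ext (\<lambda>(a, b). smul (e (bas b)) (bas a)) (tens p q) = smul (e q) p"
proof -
  have e: "e (x + y) = e x + e y" "e (smul c x) = c * e x" for x y c
    using assms by (auto simp: lin_functional_iff)
  have lin1: "lin (\<lambda>p. smul (e p) q)" "lin (smul c)" for q :: "'z \<Rightarrow>\<^sub>0 'a" and c
    by (auto intro!: linI simp: e smul_add_left smul_add mult.commute)
  show "lin_ext (\<lambda>(a, b). smul (e (bas a)) (bas b)) (tens p q) = smul (e p) q"
    by (rule bilin_eqI[where g = "\<lambda>p q. smul (e p) q"
          and f = "\<lambda>p q. lin_ext (\<lambda>(a, b). smul (e (bas a)) (bas b)) (tens p q)"])
       (simp_all add: lin_comp[OF lin_lin_ext] lin_tens lin1)
  show "lin_ext (\<lambda>(a, b). smul (e (bas b)) (bas a)) (tens p q) = smul (e q) p"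
    by (rule bilin_eqI[where g = "\<lambda>p q. smul (e q) p"
          and f = "\<lambda>p q. lin_ext (\<lambda>(a, b). smul (e (bas b)) (bas a)) (tens p q)"])
       (simp_all add: lin_comp[OF lin_lin_ext] lin_tens lin1)
qed

lemma counit_tens_map:
  assumes "lin f" and e: "Vector_Spaces.linear smul (*) e" and e': "\<And>x. e (f x) = e' x"
  shows "lin_ext (\<lambda>(a, b). smul (e (bas a)) (bas b)) (tens_map f f p)
      = f (lin_ext (\<lambda>(a, b). smul (e' (bas a)) (bas b)) p)"
    and "lin_ext (\<lambda>(a, b). smul (e (bas b)) (bas a)) (tens_map f f p)
      = f (lin_ext (\<lambda>(a, b). smul (e' (bas b)) (bas a)) p)"
  by (rule lin_eqI[where p = p], rule lin_comp[OF lin_lin_ext lin_tens_map],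
      rule lin_comp[OF assms(1) lin_lin_ext],
      force simp: counit_tens[OF e] e' lin_smul[OF assms(1)])+

text \<open>No axiom is assumed of \<open>H\<close>: as \<open>\<phi>\<close> is bijective, every
  operation of \<open>H\<close> is the conjugate of the one of \<open>T\<close>, so even bilinearity
  and associativity are inherited. The antipode is the conjugate of that of
  \<open>T\<close>.\<close>

lemma hopf_algebra_transfer:
  assumes T: "hopf_algebra T" and hom: "hopf_hom T H \<phi>" and "bij \<phi>"
  shows "hopf_algebra H"
proof -
  define \<psi> where "\<psi> = inv \<phi>"
  have \<phi>\<psi>: "\<phi> (\<psi> y) = y" and \<psi>\<phi>: "\<psi> (\<phi> x) = x" for x y
    unfolding \<psi>_def using \<open>bij \<phi>\<close> by (simp_all add: bij_is_surj surj_f_inv_f bij_is_inj)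
  have lin: "lin \<phi>" and mult: "\<And>x y. \<phi> (hmult T x y) = hmult H (\<phi> x) (\<phi> y)"
    and unit: "\<phi> (hunit T) = hunit H"
    and comult: "\<And>x. hcomult H (\<phi> x) = tens_map \<phi> \<phi> (hcomult T x)"
    and counit: "\<And>x. hcounit H (\<phi> x) = hcounit T x"
    using hom by (auto simp: hopf_hom_def)
  have lin\<psi>: "lin \<psi>"
    unfolding \<psi>_def using lin \<open>bij \<phi>\<close> by (rule lin_inv)
  have multH: "hmult H x y = \<phi> (hmult T (\<psi> x) (\<psi> y))" for x y
    by (simp add: mult \<phi>\<psi>)
  have comultH: "hcomult H x = tens_map \<phi> \<phi> (hcomult T (\<psi> x))" for x
    by (metis comult \<phi>\<psi>)
  have counitH: "hcounit H x = hcounit T (\<psi> x)" for x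
    by (metis counit \<phi>\<psi>)
  have assocT: "assoc_algebra T" and coalgT: "coalgebra T" and bialgT: "bialgebra T"
    using T by (auto simp: hopf_algebra_def bialgebra_def)
  have linH: "lin (hmult H x)" "lin (\<lambda>x. hmult H x y)" for x y
    using assocT lin lin\<psi> by (auto simp: multH assoc_algebra_def lin_iff)
  have lin_counitH: "Vector_Spaces.linear smul (*) (hcounit H)"
    using coalgT lin\<psi> by (auto simp: counitH[abs_def] coalgebra_def lin_iff lin_functional_iff)
  have assocH: "assoc_algebra H"
    unfolding assoc_algebra_def
    using assocT by (intro conjI allI linH)
      (simp_all add: assoc_algebra_def multH \<phi>\<psi> \<psi>\<phi> unit[symmetric])
  have lin_comultH: "lin (hcomult H)"
    using lin_comp[OF lin_tens_map[of \<phi> \<phi>] lin_comp[OF _ lin\<psi>, of "hcomult T"]] coalgT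
    by (simp add: comultH[abs_def] coalgebra_def)
  have coassocH: "tens_assoc (tens_map (hcomult H) id (hcomult H x))
      = tens_map id (hcomult H) (hcomult H x)" for x
  proof -
    let ?q = "hcomult T (\<psi> x)"
    \<comment> \<open>The three copies of \<open>\<phi>\<close> are pulled out of the iterated
      coproduct, leaving coassociativity of \<open>T\<close> inside.\<close>
    have "tens_assoc (tens_map (hcomult H) id (hcomult H x))
        = tens_assoc (tens_map (tens_map \<phi> \<phi>) \<phi> (tens_map (hcomult T) id ?q))"
      by (simp add: comultH[of x] tens_map_comp lin lin_comultH lin_id comult)
    also have "\<dots> = tens_map \<phi> (tens_map \<phi> \<phi>) (tens_map id (hcomult T) ?q)"
      using coalgT by (simp add: tens_assoc_tens_map lin coalgebra_def)
    also have "\<dots> = tens_map id (hcomult H) (hcomult H x)"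
      by (simp add: comultH[of x] tens_map_comp lin lin_comultH lin_id comult)
    finally show ?thesis .
  qed
  have coalgH: "coalgebra H"
    using coalgT lin_comultH lin_counitH coassocH
    by (simp add: coalgebra_def comultH counit_tens_map[OF lin lin_counitH counit] \<phi>\<psi>)
  have bialgH: "bialgebra H"
    unfolding bialgebra_def
  proof (intro conjI allI assocH coalgH)
    fix x y
    have "hcomult H (hmult H x y) = tens_map \<phi> \<phi> (hcomult T (hmult T (\<psi> x) (\<psi> y)))"
      by (simp add: multH comult)
    also have "\<dots> = tens_mult H (hcomult H x) (hcomult H y)"
      using bialgT by (simp add: bialgebra_def tens_map_tens_mult[OF lin mult linH] comultH)
    finally show "hcomult H (hmult H x y) = tens_mult H (hcomult H x) (hcomult H y)" .
    show "hcounit H (hmult H x y) = hcounit H x * hcounit H y"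
      using bialgT by (simp add: bialgebra_def multH counit) (simp add: counitH)
  next
    show "hcomult H (hunit H) = tens (hunit H) (hunit H)"
      using bialgT by (simp add: bialgebra_def unit[symmetric] comult tens_map_tens lin)
    show "hcounit H (hunit H) = 1"
      using bialgT by (simp add: bialgebra_def unit[symmetric] counit)
  qed
  obtain S where S: "is_antipode T S"
    using T by (auto simp: hopf_algebra_def)
  have linS: "lin S" using S by (simp add: is_antipode_def)
  have linS': "lin (\<lambda>x. \<phi> (S (\<psi> x)))"
    by (intro lin_comp[OF lin] lin_comp[OF linS] lin\<psi>)
  have "is_antipode H (\<lambda>x. \<phi> (S (\<psi> x)))"
    unfolding is_antipode_def
  proof (intro conjI allI linS')
    fix x
    let ?q = "hcomult T (\<psi> x)"
    have 1: "tens_map (\<lambda>x. \<phi> (S (\<psi> x))) id (hcomult H x) = tens_map \<phi> \<phi> (tens_map S id ?q)"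
      "tens_map id (\<lambda>x. \<phi> (S (\<psi> x))) (hcomult H x) = tens_map \<phi> \<phi> (tens_map id S ?q)"
      by (simp_all add: comultH tens_map_comp lin lin_id linS' \<psi>\<phi>)
    show "mult_map H (tens_map (\<lambda>x. \<phi> (S (\<psi> x))) id (hcomult H x)) = smul (hcounit H x) (hunit H)"
      and "mult_map H (tens_map id (\<lambda>x. \<phi> (S (\<psi> x))) (hcomult H x)) = smul (hcounit H x) (hunit H)"
      using S unfolding 1 mult_map_tens_map[OF lin mult linH]
      by (simp_all add: is_antipode_def lin_smul lin unit counitH)
  qed
  with bialgH show ?thesis
    by (auto simp: hopf_algebra_def)
qed

text \<open>Needed because the map constructed below runs from words to trees, while the isomorphism
  asked for starts at trees.\<close>

lemma hopf_hom_inv: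
  assumes hom: "hopf_hom T H \<phi>" and "bij \<phi>"
  shows "hopf_hom H T (inv \<phi>)"
proof -
  have \<phi>\<psi>: "\<phi> (inv \<phi> y) = y" and \<psi>\<phi>: "inv \<phi> (\<phi> x) = x" for x y
    using \<open>bij \<phi>\<close> by (simp_all add: bij_is_surj surj_f_inv_f bij_is_inj)
  have lin: "lin \<phi>" and mult: "\<And>x y. \<phi> (hmult T x y) = hmult H (\<phi> x) (\<phi> y)"
    and unit: "\<phi> (hunit T) = hunit H"
    and comult: "\<And>x. hcomult H (\<phi> x) = tens_map \<phi> \<phi> (hcomult T x)"
    and counit: "\<And>x. hcounit H (\<phi> x) = hcounit T x"
    using hom by (auto simp: hopf_hom_def)
  have lin': "lin (inv \<phi>)"
    using lin \<open>bij \<phi>\<close> by (rule lin_inv)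
  show ?thesis
    unfolding hopf_hom_def
  proof (intro conjI allI lin')
    show "inv \<phi> (hmult H x y) = hmult T (inv \<phi> x) (inv \<phi> y)" for x y
      by (metis \<phi>\<psi> \<psi>\<phi> mult)
    show "inv \<phi> (hunit H) = hunit T"
      by (metis \<psi>\<phi> unit)
    show "hcounit T (inv \<phi> x) = hcounit H x" for x
      by (metis \<phi>\<psi> counit)
    have "tens_map (inv \<phi>) (inv \<phi>) (hcomult H (\<phi> y)) = hcomult T y" for y
      by (simp add: comult tens_map_comp lin' \<psi>\<phi>)
    then show "hcomult T (inv \<phi> x) = tens_map (inv \<phi>) (inv \<phi>) (hcomult H x)" for x
      by (metis \<phi>\<psi>)
  qed
qed

section \<open>The tensor Hopf algebra on words\<close>

text \<open>The coproduct of the tensor algebra on words. The recursion is left multiplication by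
  the primitive element \<open>a \<otimes> 1 + 1 \<otimes> a\<close>.\<close>

primrec unshuffle :: "'a list \<Rightarrow> ('a list \<times> 'a list \<Rightarrow>\<^sub>0 'k::field)" where
  "unshuffle [] = bas ([], [])"
| "unshuffle (a # w) =
     lin_ext (\<lambda>x. bas (a # fst x, snd x) + bas (fst x, a # snd x)) (unshuffle w)"

text \<open>An explicit model, to be identified with the definite description
  \<open>tensor_hopf\<close>.\<close>

definition word_hopf :: "('a list, 'k::field) hopf" where
  "word_hopf =
     \<lparr> hmult = bilin_ext (\<lambda>u w. bas (u @ w)),
       hunit = bas [],
       hcomult = lin_ext unshuffle,
       hcounit = (\<lambda>p. Poly_Mapping.lookup p []) \<rparr>"

lemma word_hopf_simps [simp]:
  "hmult word_hopf = bilin_ext (\<lambda>u w. bas (u @ w))"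
  "hunit word_hopf = bas []"
  "hcomult word_hopf = lin_ext unshuffle"
  "hcounit word_hopf p = Poly_Mapping.lookup p []"
  by (simp_all add: word_hopf_def)

text \<open>Both sides sum over all ways of dealing the letters of \<open>w\<close> into three
  words. The arbitrary \<open>F\<close> replaces the triple tensor so that the induction hypothesis
  can absorb the first letter.\<close>

lemma unshuffle_coassoc:
  "lin_ext (\<lambda>x. lin_ext (\<lambda>y. F (fst y) (snd y) (snd x)) (unshuffle (fst x))) (unshuffle w)
    = lin_ext (\<lambda>x. lin_ext (\<lambda>y. F (fst x) (fst y) (snd y)) (unshuffle (snd x))) (unshuffle w)"
proof (induction w arbitrary: F)
  case Nil
  show ?case by simp
next
  case (Cons a w)
  \<comment> \<open>The three instances put the first letter into the first, second and third
    word.\<close>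
  show ?case
    using Cons[of "\<lambda>u v w. F (a # u) v w"] Cons[of "\<lambda>u v w. F u (a # v) w"]
      Cons[of "\<lambda>u v w. F u v (a # w)"]
    by (simp add: add.assoc)
qed

text \<open>Only the term with all letters on one side survives; \<open>F\<close> is arbitrary
  because that side grows by a letter at each step.\<close>

lemma unshuffle_counit:
  "lin_ext (\<lambda>x. if fst x = [] then F (snd x) else 0) (unshuffle w) = F w"
  "lin_ext (\<lambda>x. if snd x = [] then F (fst x) else 0) (unshuffle w) = F w"
  by (induction w arbitrary: F) (simp_all cong: if_cong)

lemma unshuffle_append:
  "unshuffle (u @ v) =
     lin_ext (\<lambda>x. lin_ext (\<lambda>y. bas (fst x @ fst y, snd x @ snd y)) (unshuffle v)) (unshuffle u)"
  by (induction u) simp_all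

lemma unshuffle_antipode_left:
  "lin_ext (\<lambda>x. smul ((- 1) ^ length (fst x)) (bas (rev (fst x) @ snd x))) (unshuffle w)
    = (if w = [] then bas [] else 0)"
  by (cases w) (simp_all add: smul_uminus)

text \<open>Here the first letter lands at the front or at the back, so the terms do not cancel in
  pairs; both sums are instead images of the sum for \<open>w\<close>.\<close>

lemma unshuffle_antipode_right:
  "lin_ext (\<lambda>x. smul ((- 1) ^ length (snd x)) (bas (fst x @ rev (snd x)))) (unshuffle w)
    = (if w = [] then bas [] else 0)"
proof (induction w)
  case Nil
  show ?case by simp
next
  case (Cons a w)
  \<comment> \<open>Both images vanish if \<open>w\<close> is nonempty; otherwise both equal
    \<open>bas [a]\<close>, and their difference is zero.\<close>
  from arg_cong[OF Cons, of "lin_ext (\<lambda>u. bas (a # u))"]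
    arg_cong[OF Cons, of "lin_ext (\<lambda>u. bas (u @ [a]))"]
  show ?case
    by (simp add: smul_uminus split: if_splits)
qed

lemma bialgebra_word_hopf: "bialgebra (word_hopf :: ('a list, 'k::field) hopf)"
proof -
  let ?T = "word_hopf :: ('a list, 'k::field) hopf"
  have assoc: "assoc_algebra ?T"
    by (simp add: assoc_algebra_def) (simp add: bilin_ext_def)
  have coassoc: "tens_assoc (tens_map (lin_ext unshuffle) id (lin_ext unshuffle x))
      = tens_map id (lin_ext unshuffle) (lin_ext unshuffle x)" for x :: "'a list \<Rightarrow>\<^sub>0 'k"
    using unshuffle_coassoc[where F = "\<lambda>u v w :: 'a list. bas (u, v, w) :: _ \<Rightarrow>\<^sub>0 'k"]
    by (simp add: tens_assoc_eq tens_map_eq tens_eq)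
  have coalg: "coalgebra ?T"
    unfolding coalgebra_def word_hopf_simps
    by (intro conjI allI lin_lin_ext linear_lookup coassoc)
       (simp_all add: case_prod_unfold lookup_bas if_distrib[of "\<lambda>c. smul c _"] unshuffle_counit
         cong: if_cong)
  show ?thesis
    unfolding bialgebra_def
  proof (intro conjI allI assoc coalg)
    fix x y :: "'a list \<Rightarrow>\<^sub>0 'k"
    show "hcomult ?T (hmult ?T x y) = tens_mult ?T (hcomult ?T x) (hcomult ?T y)"
    proof (rule bilin_eqI[where p = x and q = y])
      show "lin (\<lambda>y. hcomult ?T (hmult ?T x y))" for x
        by (simp add: lin_comp[OF lin_lin_ext])
      show "lin (\<lambda>x. hcomult ?T (hmult ?T x y))" for y
        by (simp add: lin_comp[OF lin_lin_ext])
      show "lin (\<lambda>y. tens_mult ?T (hcomult ?T x) (hcomult ?T y))" for x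
        unfolding tens_mult_def word_hopf_simps
        by (rule lin_comp[OF lin_bilin_ext(1) lin_lin_ext])
      show "lin (\<lambda>x. tens_mult ?T (hcomult ?T x) (hcomult ?T y))" for y
        unfolding tens_mult_def word_hopf_simps
        by (rule lin_comp[OF lin_bilin_ext(2) lin_lin_ext])
      show "hcomult ?T (hmult ?T (bas u) (bas v))
          = tens_mult ?T (hcomult ?T (bas u)) (hcomult ?T (bas v))" for u v
        by (simp add: tens_mult_eq unshuffle_append)
    qed
    show "hcounit ?T (hmult ?T x y) = hcounit ?T x * hcounit ?T y"
      by (simp add: lookup_bilin_ext lookup_bas)
  qed (simp_all add: lookup_bas)
qed

lemma hopf_algebra_word_hopf: "hopf_algebra (word_hopf :: ('a list, 'k::field) hopf)"
proof -
  let ?S = "lin_ext (\<lambda>w. smul ((- 1) ^ length w) (bas (rev w))) :: ('a list \<Rightarrow>\<^sub>0 'k) \<Rightarrow> _"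
  \<comment> \<open>As a linear extension, the right-hand side of the antipode axiom can be compared
    word by word.\<close>
  have counit: "smul (Poly_Mapping.lookup x []) (bas []) = lin_ext (\<lambda>w. if w = [] then bas [] else 0) x"
    for x :: "'a list \<Rightarrow>\<^sub>0 'k"
    by (rule lin_eqI) (auto intro!: linI simp: lookup_add smul_add_left lookup_bas)
  have "is_antipode word_hopf ?S"
    by (simp add: is_antipode_def counit mult_map_def tens_map_eq lin_ext_tens)
       (simp add: bilin_ext_def unshuffle_antipode_left unshuffle_antipode_right)
  then show ?thesis
    using bialgebra_word_hopf by (auto simp: hopf_algebra_def)
qed

lemma letter_bas [simp]: "letter (bas v) = bas [v]"
  by (simp add: letter_def)

text \<open>Uniqueness holds because words are products of letters: coproduct and counit are
  multiplicative and linear, hence fixed by their values on letters and the unit.\<close>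

lemma tensor_hopf_eq: "(tensor_hopf :: ('v list, 'k::field) hopf) = word_hopf"
  unfolding tensor_hopf_def
proof (rule the_equality)
  let ?T = "word_hopf :: ('v list, 'k) hopf"
  have comult0: "hcomult ?T (letter v) = tens (bas []) (letter v) + tens (letter v) (bas [])"
    for v :: "'v \<Rightarrow>\<^sub>0 'k"
    by (simp add: letter_def tens_eq add.commute)
  have counit0: "hcounit ?T (letter v) = 0" for v :: "'v \<Rightarrow>\<^sub>0 'k"
    by (simp add: letter_def lin_ext_def lookup_sum lookup_bas)
  show "hopf_algebra ?T \<and> hmult ?T = bilin_ext (\<lambda>u w. bas (u @ w)) \<and>
      hunit ?T = bas [] \<and>
      (\<forall>v :: 'v \<Rightarrow>\<^sub>0 'k. hcomult ?T (letter v) = tens (hunit ?T) (letter v) + tens (letter v) (hunit ?T)) \<and>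
      (\<forall>v :: 'v \<Rightarrow>\<^sub>0 'k. hcounit ?T (letter v) = 0)"
    unfolding comult0 counit0 by (simp add: hopf_algebra_word_hopf)
  fix T :: "('v list, 'k) hopf"
  assume T: "hopf_algebra T \<and> hmult T = bilin_ext (\<lambda>u w. bas (u @ w)) \<and> hunit T = bas [] \<and>
      (\<forall>v :: 'v \<Rightarrow>\<^sub>0 'k. hcomult T (letter v) = tens (hunit T) (letter v) + tens (letter v) (hunit T)) \<and>
      (\<forall>v :: 'v \<Rightarrow>\<^sub>0 'k. hcounit T (letter v) = 0)"
  have mult: "hmult T = hmult ?T" and unit: "hunit T = hunit ?T"
    using T by simp_all
  have comult: "hcomult T (letter v) = hcomult ?T (letter v)"
    and counit: "hcounit T (letter v) = hcounit ?T (letter v)" for v :: "'v \<Rightarrow>\<^sub>0 'k"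
    using T by (simp_all only: comult0 counit0)
  have T: "bialgebra T"
    using T by (simp only: hopf_algebra_def)
  have bas_Cons: "bas (v # w) = hmult ?T (letter (bas v)) (bas w)" for v w
    by simp
  have T0: "bialgebra ?T" by (rule bialgebra_word_hopf)
  \<comment> \<open>The product of the tensor square depends on the product alone, so both
    coproducts are multiplicative for the same structure.\<close>
  have tm: "tens_mult T = tens_mult ?T"
    by (simp add: tens_mult_def mult)
  have lin1: "lin (hcomult K)" "Vector_Spaces.linear smul (*) (hcounit K)"
    if "bialgebra K" for K :: "('v list, 'k) hopf"
    using that by (simp_all only: bialgebra_def coalgebra_def)
  have comult_bas: "hcomult T (bas w) = hcomult ?T (bas w)" for w
  proof (induction w)
    case Nil
    then show ?case
      using T T0 unit by (metis bialgebra_def word_hopf_simps(2))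
  next
    case (Cons v w)
    have "hcomult K (hmult K x y) = tens_mult K (hcomult K x) (hcomult K y)"
      if "bialgebra K" for x y and K :: "('v list, 'k) hopf"
      using that by (simp add: bialgebra_def)
    from this[OF T] this[OF T0] show ?case
      unfolding bas_Cons mult tm by (simp only: comult Cons.IH)
  qed
  have 1: "hcomult T = hcomult ?T"
    by (rule ext, rule lin_eqI[OF lin1(1)[OF T] lin1(1)[OF T0]], rule comult_bas)
  have counit_bas: "hcounit T (bas w) = hcounit ?T (bas w)" for w
  proof (induction w)
    case Nil
    then show ?case
      using T T0 unit by (metis bialgebra_def word_hopf_simps(2))
  next
    case (Cons v w)
    have "hcounit K (hmult K x y) = hcounit K x * hcounit K y"
      if "bialgebra K" for x y and K :: "('v list, 'k) hopf"
      using that by (simp add: bialgebra_def)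
    from this[OF T] this[OF T0] show ?case
      unfolding bas_Cons mult by (simp only: counit Cons.IH)
  qed
  have 2: "hcounit T = hcounit ?T"
    by (rule ext, rule functional_eqI[OF lin1(2)[OF T] lin1(2)[OF T0]], rule counit_bas)
  show "T = ?T"
    by (rule hopf.equality) (simp_all add: 1 2 mult unit del: word_hopf_simps)
qed

section \<open>Grafting\<close>

text \<open>The maps \<open>D\<^sub>t\<close> and \<open>d\<^sub>t\<close> on basis elements. A node
  is the root, where \<open>t\<close> becomes the leftmost child, or lies in exactly one child. A
  forest has no root, so the empty one gives 0.\<close>

fun graft_tree :: "otree \<Rightarrow> otree \<Rightarrow> (otree \<Rightarrow>\<^sub>0 'k::field)"
  and graft_forest :: "otree \<Rightarrow> otree list \<Rightarrow> (otree list \<Rightarrow>\<^sub>0 'k::field)" where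
  "graft_tree t (Node us) = bas (Node (t # us)) + lin_ext (\<lambda>l. bas (Node l)) (graft_forest t us)"
| "graft_forest t [] = 0"
| "graft_forest t (u # us) =
     lin_ext (\<lambda>s. bas (s # us)) (graft_tree t u) + lin_ext (\<lambda>l. bas (u # l)) (graft_forest t us)"

lemma graft_forest_append:
  "graft_forest t (us @ vs) =
     lin_ext (\<lambda>l. bas (l @ vs)) (graft_forest t us) + lin_ext (\<lambda>l. bas (us @ l)) (graft_forest t vs)"
  by (induction us) (simp_all add: add.assoc)

text \<open>The Leibniz rule in closed form; the list update shows that the number of trees in the
  forest is preserved.\<close>

lemma graft_forest_nth:
  "graft_forest t us = (\<Sum>i<length us. lin_ext (\<lambda>s. bas (us[i := s])) (graft_tree t (us ! i)))"
  by (induction us) (simp_all add: sum.lessThan_Suc_shift lin_ext_fun_sum del: sum.lessThan_Suc)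

section \<open>Nodes, and trees with forests attached\<close>

lemma finite_nodes [simp]: "finite (nodes y)"
  by (induction y rule: nodes.induct) simp

lemma sum_nodes:
  "(\<Sum>v\<in>nodes (Node us). h v) = h [] + (\<Sum>i<length us. \<Sum>v\<in>nodes (us ! i). h (i # v))"
proof -
  have "(\<Sum>v\<in>nodes (Node us). h v)
      = h [] + (\<Sum>v\<in>(\<Union>i\<in>{..<length us}. (#) i ` nodes (us ! i)). h v)"
    by (subst nodes.simps, subst sum.insert) auto
  also have "(\<Sum>v\<in>(\<Union>i\<in>{..<length us}. (#) i ` nodes (us ! i)). h v)
      = (\<Sum>i<length us. \<Sum>v\<in>(#) i ` nodes (us ! i). h v)"
    by (rule sum.UNION_disjoint) auto
  also have "\<dots> = (\<Sum>i<length us. \<Sum>v\<in>nodes (us ! i). h (i # v))"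
    by (simp add: sum.reindex)
  finally show ?thesis .
qed

lemma attach_upd_root:
  "attach (g([] := l)) (Node us) =
     Node (l @ map (\<lambda>i. attach (\<lambda>p. g (i # p)) (us ! i)) [0..<length us])"
  by simp

text \<open>A change at a node below child \<open>i\<close> is a list update at \<open>i\<close>,
  the shape in which \<open>graft_forest_nth\<close> describes grafting.\<close>

lemma attach_upd_child:
  assumes "i < length us"
  shows "attach (g(i # v := l)) (Node us) =
     Node (g [] @ (map (\<lambda>i. attach (\<lambda>p. g (i # p)) (us ! i)) [0..<length us])
       [i := attach ((\<lambda>p. g (i # p))(v := l)) (us ! i)])"
proof -
  have "(\<lambda>p. (g(i # v := l)) (j # p))
      = (if j = i then (\<lambda>p. g (i # p))(v := l) else (\<lambda>p. g (j # p)))" for j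
    by auto
  moreover have "(g(i # v := l)) [] = g []"
    by simp
  ultimately show ?thesis
    using assms by (auto intro!: nth_equalityI simp del: fun_upd_apply simp: nth_list_update)
qed

text \<open>
  A node of \<open>attach g y\<close> is either a node of \<open>y\<close> or a node of one of the inserted forests.
\<close>

lemma graft_tree_attach:
  "(graft_tree t (attach g y) :: otree \<Rightarrow>\<^sub>0 'k::field) =
     (\<Sum>v\<in>nodes y. bas (attach (g(v := t # g v)) y)
       + lin_ext (\<lambda>l. bas (attach (g(v := l)) y)) (graft_forest t (g v)))"
proof (induction y arbitrary: g rule: nodes.induct)
  case (1 us)
  let ?g = "\<lambda>i p. g (i # p)"
  let ?L = "map (\<lambda>i. attach (?g i) (us ! i)) [0..<length us]"
  have "lin_ext (\<lambda>s. bas (Node (g [] @ ?L[i := s]))) (graft_tree t (?L ! i))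
      = (\<Sum>v\<in>nodes (us ! i). bas (attach (g(i # v := t # g (i # v))) (Node us))
          + lin_ext (\<lambda>l. bas (attach (g(i # v := l)) (Node us))) (graft_forest t (g (i # v))) :: otree \<Rightarrow>\<^sub>0 'k)"
    if "i < length us" for i
    using that by (simp add: 1 attach_upd_child del: attach.simps fun_upd_apply)
  \<comment> \<open>The Leibniz rule separates the forest inserted at the root from the original
    children \<open>?L\<close>, to which the induction hypothesis applies.\<close>
  moreover have "(graft_tree t (attach g (Node us)) :: otree \<Rightarrow>\<^sub>0 'k) = bas (Node (t # g [] @ ?L))
      + lin_ext (\<lambda>l. bas (Node (l @ ?L))) (graft_forest t (g []))
      + (\<Sum>i<length us. lin_ext (\<lambda>s. bas (Node (g [] @ ?L[i := s]))) (graft_tree t (?L ! i)))"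
    by (simp add: graft_forest_append graft_forest_nth[of t ?L] add.assoc)
  ultimately show ?case
    by (simp add: sum_nodes attach_upd_root del: attach.simps nodes.simps fun_upd_apply)
qed

lemma attach_empty [simp]: "attach (\<lambda>_. []) y = y"
proof (induction y rule: nodes.induct)
  case (1 us)
  then have "map (\<lambda>i. attach (\<lambda>_. []) (us ! i)) [0..<length us] = us"
    by (auto intro!: nth_equalityI)
  then show ?case by simp
qed

section \<open>The product as a sum over distributions of components\<close>

text \<open>Recasts the sum over maps from components to nodes as a recursion on the components, so
  that the product is accessible to induction. Putting \<open>t\<close> in front keeps the order at
  each node.\<close>

primrec distr :: "'v set \<Rightarrow> 'a list \<Rightarrow> (('v \<Rightarrow> 'a list) \<Rightarrow>\<^sub>0 'k::field)" where
  "distr N [] = bas (\<lambda>_. [])"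
| "distr N (t # ts) = lin_ext (\<lambda>g. \<Sum>v\<in>N. bas (g(v := t # g v))) (distr N ts)"

lemma distr_eq_sum_PiE:
  "(distr N ts :: ('v \<Rightarrow> 'a list) \<Rightarrow>\<^sub>0 'k::field) =
     (\<Sum>f\<in>{..<length ts} \<rightarrow>\<^sub>E N. bas (\<lambda>v. nths ts {i. f i = v}))"
proof (induction ts)
  case Nil
  then show ?case by simp
next
  case (Cons t ts)
  let ?n = "length ts"
  \<comment> \<open>Splits a map into its value at 0 and its shift. The shift is again undefined
    outside its domain, so extensional maps correspond to pairs.\<close>
  let ?ext = "\<lambda>(v, f) i. case i of 0 \<Rightarrow> v | Suc j \<Rightarrow> f j"
  have nths: "(\<lambda>u. nths (t # ts) {i. ?ext (v, f) i = u})
      = (\<lambda>u. nths ts {i. f i = u})(v := t # nths ts {i. f i = v})" for v and f :: "nat \<Rightarrow> 'v"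
    by (auto simp: nths_Cons fun_eq_iff)
  have ext: "?ext (f 0, \<lambda>i. f (Suc i)) = f" for f :: "nat \<Rightarrow> 'v"
    by (auto simp: fun_eq_iff split: nat.splits)
  have "(\<Sum>f\<in>{..<length (t # ts)} \<rightarrow>\<^sub>E N. bas (\<lambda>v. nths (t # ts) {i. f i = v}) :: _ \<Rightarrow>\<^sub>0 'k)
      = (\<Sum>x\<in>N \<times> ({..<?n} \<rightarrow>\<^sub>E N). bas (\<lambda>v. nths (t # ts) {i. ?ext x i = v}))"
    by (rule sum.reindex_bij_witness[where j = "\<lambda>f. (f 0, \<lambda>i. f (Suc i))" and i = ?ext],
        simp_all only: ext) (auto simp: fun_eq_iff PiE_def Pi_def extensional_def split: nat.splits)
  also have "\<dots> = (\<Sum>v\<in>N. \<Sum>f\<in>{..<?n} \<rightarrow>\<^sub>E N. bas (\<lambda>u. nths (t # ts) {i. ?ext (v, f) i = u}))"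
    by (simp add: sum.cartesian_product case_prod_unfold)
  also have "\<dots> = distr N (t # ts)"
    unfolding nths by (simp add: Cons sum.swap[of _ _ N])
  finally show ?case by simp
qed

lemma nths_eq_map_filter: "nths xs A = map ((!) xs) (filter (\<lambda>i. i \<in> A) [0..<length xs])"
proof (induction xs rule: rev_induct)
  case Nil
  then show ?case by simp
next
  case (snoc x xs)
  then show ?case
    by (auto simp: nths_append nth_append intro!: map_cong)
qed

lemma components_Node [simp]: "length (components (Node ts)) = length ts"
  by (simp add: components_def)

lemma gl_mult_eq_distr: "gl_mult (Node ts) y = lin_ext (\<lambda>g. bas (attach g y)) (distr (nodes y) ts)"
proof -
  have "concat (map (\<lambda>i. children (components (Node ts) ! i)) (filter (\<lambda>i. f i = v) [0..<length ts]))
      = nths ts {i. f i = v}" for v and f :: "nat \<Rightarrow> nat list"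
  proof -
    have "map (\<lambda>i. children (components (Node ts) ! i)) (filter (\<lambda>i. f i = v) [0..<length ts])
        = map (\<lambda>i. [ts ! i]) (filter (\<lambda>i. f i = v) [0..<length ts])"
      by (auto simp: components_def)
    then show ?thesis
      by (simp only:) (simp add: nths_eq_map_filter)
  qed
  then show ?thesis
    by (simp add: gl_mult_def graft_def distr_eq_sum_PiE)
qed

text \<open>Each tree of \<open>ts\<close> is placed at exactly one element of \<open>N\<close>, so
  grafting onto a tree of the distributed forests amounts to grafting onto it before
  distributing.\<close>

lemma graft_forest_distr:
  assumes "finite N"
  shows "lin_ext (\<lambda>g. \<Sum>v\<in>N. lin_ext (\<lambda>l. bas (g(v := l))) (graft_forest t (g v))) (distr N ts)
    = (lin_ext (distr N) (graft_forest t ts) :: ('v \<Rightarrow> otree list) \<Rightarrow>\<^sub>0 'k::field)"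
proof (induction ts)
  case Nil
  then show ?case by simp
next
  case (Cons s ts)
  \<comment> \<open>With \<open>s\<close> placed at \<open>w\<close>, grafting at \<open>v\<close>
    hits an older tree, which commutes with placing \<open>s\<close>, or hits \<open>s\<close>
    itself, which requires \<open>v = w\<close>.\<close>
  have "(\<Sum>w\<in>N. \<Sum>v\<in>N. lin_ext (\<lambda>l. bas (g(w := s # g w, v := l)))
        (graft_forest t ((g(w := s # g w)) v)))
      = (\<Sum>v\<in>N. lin_ext (\<lambda>l. \<Sum>w\<in>N. bas (g(v := l, w := s # (g(v := l)) w))) (graft_forest t (g v)))
        + lin_ext (\<lambda>s'. \<Sum>w\<in>N. bas (g(w := s' # g w))) (graft_tree t s :: otree \<Rightarrow>\<^sub>0 'k)"
    for g :: "'v \<Rightarrow> otree list"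
  proof -
    have "lin_ext (\<lambda>l. bas (g(w := s # g w, v := l))) (graft_forest t ((g(w := s # g w)) v))
      = lin_ext (\<lambda>l. bas (g(v := l, w := s # (g(v := l)) w))) (graft_forest t (g v))
        + (if v = w then lin_ext (\<lambda>s'. bas (g(w := s' # g w))) (graft_tree t s :: otree \<Rightarrow>\<^sub>0 'k) else 0)" for v w
      by (auto simp: fun_upd_twist)
    then show ?thesis
      using assms by (subst (2) lin_ext_fun_sum, subst lin_ext_fun_sum, subst (2) sum.swap)
        (simp add: sum.distrib del: fun_upd_apply)
  qed
  then have "lin_ext (\<lambda>g. \<Sum>v\<in>N. lin_ext (\<lambda>l. bas (g(v := l))) (graft_forest t (g v)))
        (distr N (s # ts) :: _ \<Rightarrow>\<^sub>0 'k)
      = lin_ext (\<lambda>g. \<Sum>w\<in>N. bas (g(w := s # g w)))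
          (lin_ext (\<lambda>g. \<Sum>v\<in>N. lin_ext (\<lambda>l. bas (g(v := l))) (graft_forest t (g v))) (distr N ts))
        + lin_ext (\<lambda>g. lin_ext (\<lambda>s'. \<Sum>w\<in>N. bas (g(w := s' # g w))) (graft_tree t s)) (distr N ts)"
    by (simp del: fun_upd_apply)
  \<comment> \<open>The first summand is grafting inside \<open>ts\<close>, by the induction
    hypothesis; the second is grafting onto \<open>s\<close>.\<close>
  also have "\<dots> = lin_ext (distr N) (graft_forest t (s # ts))"
    unfolding Cons by (subst lin_ext_commute) (simp add: add.commute)
  finally show ?case .
qed

text \<open>In a term of the product, \<open>t\<close> lands on a node of \<open>y\<close>, acting
  as one more component in front of those of \<open>x\<close>, or inside an inserted tree, acting by
  \<open>graft_forest\<close> on them. These are the two parts of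
  \<open>graft_tree t x\<close>.\<close>

lemma graft_tree_gl_mult:
  "lin_ext (graft_tree t) (gl_mult x y :: otree \<Rightarrow>\<^sub>0 'k::field) = lin_ext (\<lambda>x. gl_mult x y) (graft_tree t x)"
proof (cases x)
  case (Node ts)
  have "lin_ext (\<lambda>g. \<Sum>v\<in>nodes y. lin_ext (\<lambda>l. bas (attach (g(v := l)) y)) (graft_forest t (g v)))
        (distr (nodes y) ts :: _ \<Rightarrow>\<^sub>0 'k)
      = lin_ext (\<lambda>g. bas (attach g y)) (lin_ext (\<lambda>g. \<Sum>v\<in>nodes y.
          lin_ext (\<lambda>l. bas (g(v := l))) (graft_forest t (g v))) (distr (nodes y) ts))"
    by simp
  also have "\<dots> = lin_ext (\<lambda>l. gl_mult (Node l) y) (graft_forest t ts)"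
    by (simp add: graft_forest_distr gl_mult_eq_distr)
  finally show ?thesis
    by (simp add: Node gl_mult_eq_distr graft_tree_attach sum.distrib)
qed

lemma gl_mult_one_node [simp]: "gl_mult (Node []) = bas"
  by (simp add: fun_eq_iff gl_mult_eq_distr)

text \<open>The case of \<open>graft_tree_attach\<close> with nothing attached: only the nodes of
  \<open>y\<close> remain.\<close>

lemma gl_mult_planted: "gl_mult (Node [t]) = graft_tree t"
proof
  show "gl_mult (Node [t]) y = graft_tree t y" for y
    by (simp add: gl_mult_eq_distr graft_tree_attach[of t "\<lambda>_. []" y, simplified])
qed

section \<open>Grafting and the coproduct\<close>

text \<open>Each tree goes wholly left or right, so it does not matter whether it is grafted upon
  before or after being dealt out.\<close>

lemma unshuffle_graft_forest:
  "lin_ext unshuffle (graft_forest t us :: otree list \<Rightarrow>\<^sub>0 'k::field) = lin_ext (\<lambda>x.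
     lin_ext (\<lambda>l. bas (l, snd x)) (graft_forest t (fst x))
     + lin_ext (\<lambda>l. bas (fst x, l)) (graft_forest t (snd x))) (unshuffle us)"
proof (induction us)
  case Nil
  then show ?case by simp
next
  case (Cons u us)
  have "lin_ext unshuffle (graft_forest t (u # us) :: otree list \<Rightarrow>\<^sub>0 'k)
      = lin_ext (\<lambda>s. lin_ext (\<lambda>x. bas (s # fst x, snd x)) (unshuffle us)) (graft_tree t u)
      + lin_ext (\<lambda>s. lin_ext (\<lambda>x. bas (fst x, s # snd x)) (unshuffle us)) (graft_tree t u)
      + lin_ext (\<lambda>x. bas (u # fst x, snd x) + bas (fst x, u # snd x))
          (lin_ext unshuffle (graft_forest t us))"
    by simp
  then show ?case
    unfolding Cons lin_ext_commute[of _ "unshuffle us" "graft_tree t u"]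
    by (simp add: algebra_simps)
qed

text \<open>Choosing \<open>S\<close> decides for each component whether it goes left or right,
  which \<open>unshuffle\<close> does one letter at a time.\<close>

lemma gl_comult_eq_unshuffle:
  "(gl_comult (Node ts) :: _ \<Rightarrow>\<^sub>0 'k::field) = lin_ext (\<lambda>x. bas (Node (fst x), Node (snd x))) (unshuffle ts)"
proof -
  have merge: "foldr merge (map (\<lambda>t. Node [t]) us) (Node []) = Node us" for us
    by (induction us) (simp_all add: merge_def)
  have subtree: "subtree (Node ts) S = Node (nths ts S)" for S
    by (simp add: subtree_def components_def nths_map merge)
  have unshuffle: "(\<Sum>S\<in>Pow {..<length ts}. bas (nths ts S, nths ts ({..<length ts} - S))) = (unshuffle ts :: _ \<Rightarrow>\<^sub>0 'k)"
  proof (induction ts)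
    case Nil
    then show ?case by simp
  next
    case (Cons t ts)
    let ?n = "length ts"
    let ?f = "\<lambda>S. bas (nths (t # ts) S, nths (t # ts) ({..<Suc ?n} - S)) :: _ \<Rightarrow>\<^sub>0 'k"
    have lessThan: "{..<Suc ?n} = insert 0 (Suc ` {..<?n})"
      by (rule lessThan_Suc_eq_insert_0)
    have inj: "inj_on ((`) Suc) A" "inj_on (insert 0) ((`) Suc ` A)" for A
      by (auto simp: inj_on_def inj_image_eq_iff)
    \<comment> \<open>Subsets without 0 send the first component right, those with 0 send it left;
      the remaining indices are shifted by one.\<close>
    have "(\<Sum>S\<in>Pow {..<Suc ?n}. ?f S)
        = (\<Sum>S\<in>Pow (Suc ` {..<?n}). ?f S) + (\<Sum>S\<in>insert 0 ` Pow (Suc ` {..<?n}). ?f S)"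
      unfolding lessThan Pow_insert by (rule sum.union_disjoint) auto
    also have "Pow (Suc ` {..<?n}) = (`) Suc ` Pow {..<?n}"
      by (simp add: image_Pow_surj)
    also have "(\<Sum>S\<in>(`) Suc ` Pow {..<?n}. ?f S)
        = (\<Sum>S\<in>Pow {..<?n}. bas (nths ts S, t # nths ts ({..<?n} - S)))"
      by (subst sum.reindex[OF inj(1)]) (auto simp: nths_Cons inj_image_mem_iff set_diff_eq intro!: sum.cong)
    also have "(\<Sum>S\<in>insert 0 ` (`) Suc ` Pow {..<?n}. ?f S)
        = (\<Sum>S\<in>Pow {..<?n}. bas (t # nths ts S, nths ts ({..<?n} - S)))"
      by (subst sum.reindex[OF inj(2)], subst sum.reindex[OF inj(1)])
         (auto simp: nths_Cons inj_image_mem_iff set_diff_eq intro!: sum.cong)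
    finally show ?case
      by (simp add: Cons[symmetric] sum.distrib add.commute)
  qed
  then show ?thesis
    by (simp add: gl_comult_def subtree flip: unshuffle)
qed

text \<open>The summand \<open>Node (t # us)\<close> sends the new component left or right, and the
  rest is the coderivation property of \<open>graft_forest\<close>.\<close>

lemma gl_comult_graft_tree:
  "lin_ext gl_comult (graft_tree t x :: otree \<Rightarrow>\<^sub>0 'k::field) = lin_ext (\<lambda>y.
     lin_ext (\<lambda>z. bas (z, snd y)) (graft_tree t (fst y))
     + lin_ext (\<lambda>z. bas (fst y, z)) (graft_tree t (snd y))) (gl_comult x)"
proof (cases x)
  case (Node us)
  have "lin_ext gl_comult (graft_tree t x :: otree \<Rightarrow>\<^sub>0 'k) = gl_comult (Node (t # us))
      + lin_ext (\<lambda>x. bas (Node (fst x), Node (snd x))) (lin_ext unshuffle (graft_forest t us))"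
    by (simp add: Node gl_comult_eq_unshuffle)
  then show ?thesis
    unfolding unshuffle_graft_forest
    by (simp add: Node gl_comult_eq_unshuffle algebra_simps)
qed

section \<open>From words to trees\<close>

text \<open>Lets an induction hypothesis about forests of a fixed length pass under
  \<open>graft_forest\<close>.\<close>

lemma graft_forest_cong:
  assumes "\<And>l. length l = length us \<Longrightarrow> f l = g l"
  shows "lin_ext f (graft_forest t us) = lin_ext g (graft_forest t us)"
  by (simp add: graft_forest_nth assms)

lemma grossman_larson_simps [simp]:
  "hmult grossman_larson = bilin_ext gl_mult"
  "hunit grossman_larson = bas (Node [])"
  "hcomult grossman_larson = lin_ext gl_comult"
  "hcounit grossman_larson p = Poly_Mapping.lookup p (Node [])"
  by (simp_all add: grossman_larson_def)

text \<open>A letter \<open>v\<close> stands for the planted tree \<open>Node [g v]\<close>. The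
  parameter \<open>g\<close> allows letters to be plain trees for free generation and planted trees
  for the isomorphism.\<close>

primrec word_prod :: "('v \<Rightarrow> otree) \<Rightarrow> 'v list \<Rightarrow> (otree \<Rightarrow>\<^sub>0 'k::field)" where
  "word_prod g [] = bas (Node [])"
| "word_prod g (v # w) = lin_ext (graft_tree (g v)) (word_prod g w)"

text \<open>
  The argument \<open>n\<close> is the length of \<open>us\<close>; it makes the recursion structural.
\<close>

primrec forest_words :: "(otree \<Rightarrow> 'v) \<Rightarrow> nat \<Rightarrow> otree list \<Rightarrow> ('v list \<Rightarrow>\<^sub>0 'k::field)" where
  "forest_words h 0 us = bas []"
| "forest_words h (Suc n) us =
     lin_ext (\<lambda>w. bas (h (hd us) # w)) (forest_words h n (tl us))
     - lin_ext (forest_words h n) (graft_forest (hd us) (tl us))"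

text \<open>The recursion of \<open>forest_words\<close> is carried to
  \<open>Node (t # ts) = D\<^sub>t (Node ts) - Node (d\<^sub>t ts)\<close>. All forests in
  \<open>d\<^sub>t ts\<close> are as long as \<open>ts\<close>, so the induction hypothesis covers
  both terms.\<close>

lemma word_prod_forest_words:
  assumes "\<And>t. g (h t) = t"
  shows "length us = n \<Longrightarrow>
    lin_ext (word_prod g) (forest_words h n us) = (bas (Node us) :: otree \<Rightarrow>\<^sub>0 'k::field)"
proof (induction n arbitrary: us)
  case 0
  then show ?case by simp
next
  case (Suc n)
  then obtain t ts where us: "us = t # ts" and n: "length ts = n"
    by (cases us) auto
  have "lin_ext (word_prod g) (lin_ext (\<lambda>w. bas (h t # w)) (forest_words h n ts))
      = lin_ext (graft_tree t) (lin_ext (word_prod g) (forest_words h n ts) :: otree \<Rightarrow>\<^sub>0 'k)"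
    by (simp add: assms)
  also have "\<dots> = graft_tree t (Node ts)"
    by (subst Suc.IH[OF n]) simp
  finally have 1: "lin_ext (word_prod g) (lin_ext (\<lambda>w. bas (h t # w)) (forest_words h n ts))
      = (graft_tree t (Node ts) :: otree \<Rightarrow>\<^sub>0 'k)" .
  have 2: "lin_ext (word_prod g) (lin_ext (forest_words h n) (graft_forest t ts))
      = (lin_ext (\<lambda>l. bas (Node l)) (graft_forest t ts) :: otree \<Rightarrow>\<^sub>0 'k)"
    unfolding lin_ext_bind by (rule graft_forest_cong) (simp add: Suc.IH n)
  show ?case
    unfolding us forest_words.simps lin_ext_diff list.sel 1 2 by simp
qed

text \<open>The term subtracted in \<open>forest_words\<close> for \<open>t # ts\<close> cancels the
  \<open>graft_forest\<close> part of \<open>graft_tree\<close>, so grafting \<open>t\<close>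
  becomes prefixing the letter \<open>h t\<close>.\<close>

lemma forest_words_graft_tree:
  "lin_ext (\<lambda>y. forest_words h (length (children y)) (children y)) (graft_tree t x)
    = (lin_ext (\<lambda>w. bas (h t # w)) (forest_words h (length (children x)) (children x))
        :: _ \<Rightarrow>\<^sub>0 'k::field)"
proof (cases x)
  case (Node ts)
  have "lin_ext (\<lambda>l. forest_words h (length l) l) (graft_forest t ts)
      = (lin_ext (forest_words h (length ts)) (graft_forest t ts) :: _ \<Rightarrow>\<^sub>0 'k)"
    by (rule graft_forest_cong) simp
  then show ?thesis
    by (simp add: Node)
qed

lemma forest_words_word_prod:
  assumes "\<And>v. h (g v) = v"
  shows "lin_ext (\<lambda>y. forest_words h (length (children y)) (children y)) (word_prod g w)
    = (bas w :: _ \<Rightarrow>\<^sub>0 'k::field)"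
proof (induction w)
  case Nil
  then show ?case by simp
next
  case (Cons v w)
  let ?\<psi> = "\<lambda>y. forest_words h (length (children y)) (children y) :: _ \<Rightarrow>\<^sub>0 'k"
  have "lin_ext ?\<psi> (word_prod g (v # w))
      = lin_ext (\<lambda>w. bas (v # w)) (lin_ext ?\<psi> (word_prod g w))"
    by (simp add: forest_words_graft_tree assms)
  then show ?case
    by (simp add: Cons)
qed

lemma bij_word_prod:
  assumes "bij g"
  shows "bij (lin_ext (word_prod g) :: _ \<Rightarrow> otree \<Rightarrow>\<^sub>0 'k::field)"
proof (rule o_bij)
  let ?h = "inv g"
  let ?\<psi> = "lin_ext (\<lambda>y. forest_words ?h (length (children y)) (children y))
    :: (otree \<Rightarrow>\<^sub>0 'k) \<Rightarrow> _"
  have g: "g (?h t) = t" "?h (g v) = v" for t v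
    using assms by (simp_all add: bij_is_inj bij_is_surj surj_f_inv_f)
  show "?\<psi> \<circ> lin_ext (word_prod g) = id"
    by (simp add: fun_eq_iff forest_words_word_prod[of ?h g, OF g(2)])
  show "lin_ext (word_prod g) \<circ> ?\<psi> = id"
    by (simp add: fun_eq_iff word_prod_forest_words[of g ?h, OF g(1)])
qed

section \<open>Compatibility of the word product with the Hopf structures\<close>

lemma graft_tree_mult:
  "lin_ext (graft_tree t) (bilin_ext gl_mult x y)
    = (bilin_ext gl_mult (lin_ext (graft_tree t) x) y :: otree \<Rightarrow>\<^sub>0 'k::field)"
  by (simp add: bilin_ext_def graft_tree_gl_mult lin_ext_commute[of _ y])

lemma one_node_mult: "bilin_ext gl_mult (bas (Node [])) y = y"
  by (simp add: bilin_ext_def)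

lemma planted_mult: "bilin_ext gl_mult (bas (Node [t])) y = lin_ext (graft_tree t) y"
  by (simp add: bilin_ext_def gl_mult_planted)

lemma word_prod_append:
  "word_prod g (u @ w) = bilin_ext gl_mult (word_prod g u) (word_prod g w)"
  by (induction u) (simp_all add: one_node_mult graft_tree_mult)

text \<open>Every tree produced by grafting has a child at its root, so the counit vanishes on
  it.\<close>

lemma lookup_graft_tree_one_node: "Poly_Mapping.lookup (graft_tree t x) (Node []) = 0"
  by (cases x) (auto simp: lookup_add lookup_bas graft_forest_nth lookup_sum lookup_lin_ext)

lemma lookup_word_prod_one_node:
  "Poly_Mapping.lookup (word_prod g w) (Node []) = (if w = [] then 1 else 0)"
  by (cases w) (simp_all add: lookup_bas lookup_lin_ext lookup_graft_tree_one_node)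

text \<open>A further letter acts as a coderivation on both sides: on trees by
  \<open>gl_comult_graft_tree\<close>, on words by the recursion of
  \<open>unshuffle\<close>.\<close>

lemma gl_comult_word_prod:
  "lin_ext gl_comult (word_prod g w)
    = (tens_map (lin_ext (word_prod g)) (lin_ext (word_prod g)) (unshuffle w) :: _ \<Rightarrow>\<^sub>0 'k::field)"
proof (induction w)
  case Nil
  then show ?case by (simp add: gl_comult_eq_unshuffle)
next
  case (Cons v w)
  let ?Q = "\<lambda>y. lin_ext (\<lambda>z. bas (z, snd y)) (graft_tree (g v) (fst y))
     + lin_ext (\<lambda>z. bas (fst y, z)) (graft_tree (g v) (snd y)) :: otree \<times> otree \<Rightarrow>\<^sub>0 'k"
  have "lin_ext gl_comult (word_prod g (v # w)) = lin_ext ?Q (lin_ext gl_comult (word_prod g w))"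
    by (simp add: gl_comult_graft_tree)
  \<comment> \<open>Grafting onto the first tensor factor happens after expanding the second on one
    side and before it on the other, so the sums are exchanged.\<close>
  also have "\<dots> = tens_map (lin_ext (word_prod g)) (lin_ext (word_prod g)) (unshuffle (v # w))"
    unfolding Cons
    by (simp add: tens_map_eq tens_eq)
       (simp add: lin_ext_commute[where p = "graft_tree (g v) _"])
  finally show ?case .
qed

lemma hopf_hom_word_prod:
  "hopf_hom word_hopf grossman_larson (lin_ext (word_prod g) :: _ \<Rightarrow> otree \<Rightarrow>\<^sub>0 'k::field)"
  (is "hopf_hom _ _ ?\<phi>")
  unfolding hopf_hom_def word_hopf_simps grossman_larson_simps
proof (intro conjI allI lin_lin_ext)
  show "?\<phi> (bilin_ext (\<lambda>u w. bas (u @ w)) x y) = bilin_ext gl_mult (?\<phi> x) (?\<phi> y)" for x y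
  proof (rule bilin_eqI[where p = x and q = y])
    show "lin (\<lambda>y. ?\<phi> (bilin_ext (\<lambda>u w. bas (u @ w)) x y))"
      "lin (\<lambda>x. ?\<phi> (bilin_ext (\<lambda>u w. bas (u @ w)) x y))" for x y
      by (rule lin_comp[OF lin_lin_ext], rule lin_bilin_ext)+
    show "lin (\<lambda>y. bilin_ext gl_mult (?\<phi> x) (?\<phi> y))" for x
      by (rule lin_comp[OF lin_bilin_ext(1) lin_lin_ext])
    show "lin (\<lambda>x. bilin_ext gl_mult (?\<phi> x) (?\<phi> y))" for y
      by (rule lin_comp[OF lin_bilin_ext(2) lin_lin_ext])
    show "?\<phi> (bilin_ext (\<lambda>u w. bas (u @ w)) (bas u) (bas w))
        = bilin_ext gl_mult (?\<phi> (bas u)) (?\<phi> (bas w))" for u w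
      by (simp add: word_prod_append)
  qed
  show "?\<phi> (bas []) = bas (Node [])"
    by simp
  show "lin_ext gl_comult (?\<phi> x) = tens_map ?\<phi> ?\<phi> (lin_ext unshuffle x)" for x
    by (rule lin_eqI[where p = x])
       (simp_all only: lin_comp[OF lin_lin_ext lin_lin_ext] lin_comp[OF lin_tens_map lin_lin_ext]
         lin_ext_bas gl_comult_word_prod)
  show "Poly_Mapping.lookup (?\<phi> x) (Node []) = Poly_Mapping.lookup x []" for x
    by (rule functional_eqI[OF lin_functional_comp[OF linear_lookup lin_lin_ext] linear_lookup])
       (simp add: lookup_word_prod_one_node lookup_bas)
qed

section \<open>Free generation and the Hopf isomorphism\<close>

lemma planted_iff: "planted x \<longleftrightarrow> (\<exists>t. x = Node [t])"
  by (cases x) (auto simp: planted_def length_Suc_conv)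

lemma freely_generates_planted:
  "freely_generates (bas ` {x. planted x}) (grossman_larson :: (otree, 'k::field) hopf)"
proof -
  let ?L = "\<lambda>t. bas (Node [t]) :: otree \<Rightarrow>\<^sub>0 'k"
  \<comment> \<open>Turns words with letters \<open>t\<close> into words in the basis vectors of the
    planted trees \<open>Node [t]\<close>, the domain of \<open>word_eval\<close> in free
    generation.\<close>
  let ?r = "lin_ext (\<lambda>w. bas (map ?L w)) :: (otree list \<Rightarrow>\<^sub>0 'k) \<Rightarrow> _"
  let ?H = "grossman_larson :: (otree, 'k) hopf"
  have planted: "bas ` {x. planted x} = range ?L"
    by (auto simp: planted_iff)
  have "inj (map ?L)"
    by (auto simp: inj_def bas_inj)
  then have r: "bij_betw ?r UNIV {p. Poly_Mapping.keys p \<subseteq> lists (bas ` {x. planted x})}"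
    using bij_betw_lin_ext_bas[of "map ?L"] by (simp add: planted lists_image)
  \<comment> \<open>Left multiplication by a planted tree is grafting, so evaluation after
    \<open>?r\<close> is the map already known to be bijective.\<close>
  have "foldr (hmult ?H) (map ?L w) (hunit ?H) = word_prod id w" for w
    by (induction w) (simp_all add: planted_mult)
  then have "word_eval ?H \<circ> ?r = lin_ext (word_prod id)"
    by (simp add: fun_eq_iff word_eval_def)
  moreover have "bij (lin_ext (word_prod id) :: _ \<Rightarrow> otree \<Rightarrow>\<^sub>0 'k)"
    by (rule bij_word_prod) simp
  ultimately show ?thesis
    unfolding freely_generates_def using bij_betw_comp_iff[OF r, of "word_eval ?H" UNIV] by simp
qed

lemma hopf_isomorphic_tensor:
  "hopf_isomorphic (grossman_larson :: (otree, 'k::field) hopf)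
    (tensor_hopf :: (planted_tree list, 'k) hopf)"
proof -
  \<comment> \<open>A planted tree is determined by the subtree at the only child of its root, so
    this is a bijection from letters to trees.\<close>
  let ?g = "\<lambda>p. hd (children (Rep_planted_tree p))"
  let ?h = "\<lambda>t. Abs_planted_tree (Node [t])"
  have gh: "?g (?h t) = t" for t
    by (simp add: Abs_planted_tree_inverse planted_iff)
  have "Node [?g p] = Rep_planted_tree p" for p
    using Rep_planted_tree[of p] by (auto simp: planted_iff)
  then have hg: "?h (?g p) = p" for p
    by (simp add: Rep_planted_tree_inverse)
  have "bij ?g"
    by (rule o_bij[of ?h]) (simp_all add: fun_eq_iff gh hg)
  note bij = bij_word_prod[OF this] and hom = hopf_hom_word_prod[of ?g]
  show ?thesis
    unfolding hopf_isomorphic_def tensor_hopf_eq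
    using hopf_algebra_transfer[OF hopf_algebra_word_hopf hom bij] hopf_algebra_word_hopf
      hopf_hom_inv[OF hom bij] bij_imp_bij_inv[OF bij] by blast
qed

theorem corollary2p7:
  shows "freely_generates (bas ` {x. planted x}) (grossman_larson :: (otree, 'k::field) hopf) \<and>
         hopf_isomorphic (grossman_larson :: (otree, 'k) hopf)
                         (tensor_hopf :: (planted_tree list, 'k) hopf)"
  using freely_generates_planted hopf_isomorphic_tensor by blast

end
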